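(* Let $\phi$ be a first-order formula over the vocabulary $\{\subseteq,\preceq\}$. Then $\textsc{Eval}(\phi)$ is in $\mathrm{P}$.
   Context: A partial instance of dimension $n$ is a tuple in $\{0,1,\bot\}^n$; write $\mathbf{e}_\bot=\{i\mid\mathbf{e}[i]=\bot\}$. For a decision tree $\mathcal{T}$ of dimension $n$ (a rooted binary tree with internal nodes labeled by features in $\{1,\dots,n\}$, edges labeled $0/1$, leaves labeled $\mathsf{true}/\mathsf{false}$, no feature repeated on a root-to-leaf path), formulas over $\{\subseteq,\preceq\}$ are interpreted over the domain $\{0,1,\bot\}^n$ where $\mathbf{e}_1\subseteq\mathbf{e}_2$ iff $\mathbf{e}_1[i]=\mathbf{e}_2[i]$ for every $i$ with $\mathbf{e}_1[i]\neq\bot$ (subsumption), and $\mathbf{e}\preceq\mathbf{e}'$ iff $|\mathbf{e}_\bot|\ge|\mathbf{e}'_\bot|$. For a fixed formula $\phi(x_1,\dots,x_k)$, $\textsc{Eval}(\phi)$ takes as input a decision tree $\mathcal{T}$ of dimension $n$ and partial instances $\mathbf{e}_1,\dots,\mathbf{e}_k$ of dimension $n$ and asks whether $\mathcal{T}\models\phi(\mathbf{e}_1,\dots,\mathbf{e}_k)$. *)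

theory Defs
  imports "HOL-Computational_Algebra.Polynomial"
begin

section \<open>Deterministic multi-tape Turing machines and the class P\<close>

text \<open>
  A machine has finitely many two-way infinite tapes.  Tape symbols are the blank, the letters of
  the input alphabet \<^typ>\<open>'a\<close>, and auxiliary symbols; the tape alphabet of a machine is a finite
  set of such symbols.
\<close>

datatype 'a cell = Blank | Input 'a | Work nat

datatype move = MoveLeft | MoveRight | Stay

record 'a tm =
  tm_tapes :: nat
  tm_states :: "nat set"
  tm_alphabet :: "'a cell set"
  tm_start :: nat
  tm_accept :: nat
  tm_reject :: nat
  tm_delta :: "nat \<Rightarrow> 'a cell list \<Rightarrow> nat \<times> ('a cell \<times> move) list"

definition turing_machine :: "'a::finite tm \<Rightarrow> bool" where
  "turing_machine M \<longleftrightarrow>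
     tm_tapes M \<ge> 1 \<and>
     finite (tm_states M) \<and>
     finite (tm_alphabet M) \<and>
     insert Blank (range Input) \<subseteq> tm_alphabet M \<and>
     {tm_start M, tm_accept M, tm_reject M} \<subseteq> tm_states M \<and>
     tm_accept M \<noteq> tm_reject M \<and>
     (\<forall>q \<in> tm_states M - {tm_accept M, tm_reject M}.
        \<forall>ss. length ss = tm_tapes M \<and> set ss \<subseteq> tm_alphabet M \<longrightarrow>
          fst (tm_delta M q ss) \<in> tm_states M \<and>
          length (snd (tm_delta M q ss)) = tm_tapes M \<and>
          fst ` set (snd (tm_delta M q ss)) \<subseteq> tm_alphabet M)"

text \<open>A tape is its contents together with the head position.\<close>

type_synonym 'a tape = "(int \<Rightarrow> 'a cell) \<times> int"

type_synonym 'a config = "nat \<times> 'a tape list"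

definition tape_read :: "'a tape \<Rightarrow> 'a cell" where
  "tape_read tp = fst tp (snd tp)"

fun head_shift :: "move \<Rightarrow> int" where
  "head_shift MoveLeft = -1"
| "head_shift MoveRight = 1"
| "head_shift Stay = 0"

fun tape_act :: "'a cell \<times> move \<Rightarrow> 'a tape \<Rightarrow> 'a tape" where
  "tape_act (s, m) (c, h) = (c(h := s), h + head_shift m)"

definition tm_step :: "'a tm \<Rightarrow> 'a config \<Rightarrow> 'a config" where
  "tm_step M cf =
     (case cf of (q, tps) \<Rightarrow>
        if q = tm_accept M \<or> q = tm_reject M then (q, tps)
        else (case tm_delta M q (map tape_read tps) of
                (q', acts) \<Rightarrow> (q', map2 tape_act acts tps)))"

definition blank_tape :: "'a tape" where
  "blank_tape = (\<lambda>_. Blank, 0)"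

definition input_tape :: "'a list \<Rightarrow> 'a tape" where
  "input_tape w =
     (\<lambda>i. if 0 \<le> i \<and> i < int (length w) then Input (w ! nat i) else Blank, 0)"

definition tm_initial :: "'a tm \<Rightarrow> 'a list \<Rightarrow> 'a config" where
  "tm_initial M w = (tm_start M, input_tape w # replicate (tm_tapes M - 1) blank_tape)"

definition decides_in_time :: "'a tm \<Rightarrow> 'a list set \<Rightarrow> (nat \<Rightarrow> nat) \<Rightarrow> bool" where
  "decides_in_time M A f \<longleftrightarrow>
     (\<forall>w. \<exists>s \<le> f (length w).
        fst ((tm_step M ^^ s) (tm_initial M w)) =
          (if w \<in> A then tm_accept M else tm_reject M))"

definition PTIME :: "'a::finite list set set" where
  "PTIME = {A. \<exists>M. turing_machine M \<and> (\<exists>p :: nat poly. decides_in_time M A (poly p))}"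


section \<open>Partial instances\<close>

text \<open>
  \<^term>\<open>None\<close> is the undefined value; coordinate \<open>i \<in> {1..n}\<close> is stored at list position \<open>i - 1\<close>.
\<close>

type_synonym pinst = "bool option list"

definition pinsts :: "nat \<Rightarrow> pinst set" where
  "pinsts n = {e. length e = n}"

definition undef_coords :: "pinst \<Rightarrow> nat set" where
  "undef_coords e = {i. i < length e \<and> e ! i = None}"

definition subsumed :: "pinst \<Rightarrow> pinst \<Rightarrow> bool" where
  "subsumed e1 e2 \<longleftrightarrow> (\<forall>i < length e1. e1 ! i \<noteq> None \<longrightarrow> e1 ! i = e2 ! i)"

definition less_defined :: "pinst \<Rightarrow> pinst \<Rightarrow> bool" where
  "less_defined e1 e2 \<longleftrightarrow> card (undef_coords e1) \<ge> card (undef_coords e2)"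


section \<open>Decision trees\<close>

text \<open>In \<open>Node i t0 t1\<close> the edges to \<open>t0\<close> and \<open>t1\<close> are labeled 0 and 1.\<close>

datatype btree = Leaf bool | Node nat btree btree

fun features :: "btree \<Rightarrow> nat set" where
  "features (Leaf b) = {}"
| "features (Node i t0 t1) = insert i (features t0 \<union> features t1)"

text \<open>The sequences of features read along the root-to-leaf paths.\<close>

fun paths :: "btree \<Rightarrow> nat list set" where
  "paths (Leaf b) = {[]}"
| "paths (Node i t0 t1) = (\<lambda>p. i # p) ` (paths t0 \<union> paths t1)"

record dtree =
  dt_dim :: nat
  dt_tree :: btree

definition decision_tree :: "dtree \<Rightarrow> bool" where
  "decision_tree T \<longleftrightarrow>
     features (dt_tree T) \<subseteq> {1..dt_dim T} \<and> (\<forall>p \<in> paths (dt_tree T). distinct p)"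


section \<open>First-order logic over subsumption and the cardinality preorder\<close>

datatype fo =
    Subs nat nat
  | Prec nat nat
  | Equal nat nat
  | Neg fo
  | Conj fo fo
  | Disj fo fo
  | Exists nat fo
  | Forall nat fo

fun free_vars :: "fo \<Rightarrow> nat set" where
  "free_vars (Subs x y) = {x, y}"
| "free_vars (Prec x y) = {x, y}"
| "free_vars (Equal x y) = {x, y}"
| "free_vars (Neg \<phi>) = free_vars \<phi>"
| "free_vars (Conj \<phi> \<psi>) = free_vars \<phi> \<union> free_vars \<psi>"
| "free_vars (Disj \<phi> \<psi>) = free_vars \<phi> \<union> free_vars \<psi>"
| "free_vars (Exists x \<phi>) = free_vars \<phi> - {x}"
| "free_vars (Forall x \<phi>) = free_vars \<phi> - {x}"

fun sat :: "dtree \<Rightarrow> (nat \<Rightarrow> pinst) \<Rightarrow> fo \<Rightarrow> bool" where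
  "sat T \<sigma> (Subs x y) \<longleftrightarrow> subsumed (\<sigma> x) (\<sigma> y)"
| "sat T \<sigma> (Prec x y) \<longleftrightarrow> less_defined (\<sigma> x) (\<sigma> y)"
| "sat T \<sigma> (Equal x y) \<longleftrightarrow> \<sigma> x = \<sigma> y"
| "sat T \<sigma> (Neg \<phi>) \<longleftrightarrow> \<not> sat T \<sigma> \<phi>"
| "sat T \<sigma> (Conj \<phi> \<psi>) \<longleftrightarrow> sat T \<sigma> \<phi> \<and> sat T \<sigma> \<psi>"
| "sat T \<sigma> (Disj \<phi> \<psi>) \<longleftrightarrow> sat T \<sigma> \<phi> \<or> sat T \<sigma> \<psi>"
| "sat T \<sigma> (Exists x \<phi>) \<longleftrightarrow> (\<exists>e \<in> pinsts (dt_dim T). sat T (\<sigma>(x := e)) \<phi>)"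
| "sat T \<sigma> (Forall x \<phi>) \<longleftrightarrow> (\<forall>e \<in> pinsts (dt_dim T). sat T (\<sigma>(x := e)) \<phi>)"

text \<open>
  For distinct variables \<open>xs = [x\<^sub>1, \<dots>, x\<^sub>k]\<close> covering the free variables of \<open>\<phi>\<close>,
  \<open>models T \<phi> xs [e\<^sub>1, \<dots>, e\<^sub>k]\<close> is \<open>T \<Turnstile> \<phi>(e\<^sub>1, \<dots>, e\<^sub>k)\<close>.
\<close>

definition models :: "dtree \<Rightarrow> fo \<Rightarrow> nat list \<Rightarrow> pinst list \<Rightarrow> bool" where
  "models T \<phi> xs es \<longleftrightarrow> sat T (\<lambda>x. the (map_of (zip xs es) x)) \<phi>"


section \<open>The evaluation problem as a formal language\<close>

datatype sym = Zero | One | Bot | Tally | Sep | LeafTrue | LeafFalse | Inner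

lemma UNIV_sym: "UNIV = {Zero, One, Bot, Tally, Sep, LeafTrue, LeafFalse, Inner}"
proof -
  have "x \<in> {Zero, One, Bot, Tally, Sep, LeafTrue, LeafFalse, Inner}" for x
    by (cases x) auto
  then show ?thesis by blast
qed

instance sym :: finite
  by standard (simp add: UNIV_sym)

text \<open>
  Trees are written in preorder.  The dimension and the features are written in unary; since
  features are at most the dimension, and a partial instance of dimension \<open>n\<close> occupies \<open>n\<close> letters
  anyway, this makes the length of an input polynomial in \<open>n\<close>, the number of nodes and \<open>k\<close>.
\<close>

fun encode_btree :: "btree \<Rightarrow> sym list" where
  "encode_btree (Leaf b) = [if b then LeafTrue else LeafFalse]"
| "encode_btree (Node i t0 t1) =
     Inner # replicate i Tally @ encode_btree t0 @ encode_btree t1"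

fun encode_value :: "bool option \<Rightarrow> sym" where
  "encode_value None = Bot"
| "encode_value (Some b) = (if b then One else Zero)"

definition encode_pinst :: "pinst \<Rightarrow> sym list" where
  "encode_pinst e = map encode_value e"

definition encode :: "dtree \<Rightarrow> pinst list \<Rightarrow> sym list" where
  "encode T es =
     replicate (dt_dim T) Tally @ Sep # encode_btree (dt_tree T) @
     concat (map (\<lambda>e. Sep # encode_pinst e) es)"

definition Eval :: "fo \<Rightarrow> nat list \<Rightarrow> sym list set" where
  "Eval \<phi> xs =
     {encode T es | T es. decision_tree T \<and> length es = length xs \<and>
        set es \<subseteq> pinsts (dt_dim T) \<and> models T \<phi> xs es}"


subsection \<open>The encoding is injective\<close>

lemma replicate_Tally_append_eq:
  assumes "replicate i Tally @ x # u = replicate j Tally @ y # v" "x \<noteq> Tally" "y \<noteq> Tally"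
  shows "i = j \<and> x # u = y # v"
  using assms(1)
proof (induction i arbitrary: j)
  case 0
  then show ?case using assms by (cases j) auto
next
  case (Suc i)
  then show ?case using assms by (cases j) auto
qed

lemma encode_btree_Cons: "\<exists>x u. encode_btree t = x # u \<and> x \<noteq> Tally"
  by (cases t) auto

lemma encode_btree_append_eq:
  "encode_btree t @ u = encode_btree t' @ u' \<Longrightarrow> t = t' \<and> u = u'"
proof (induction t arbitrary: t' u u')
  case (Leaf b)
  then show ?case by (cases t') (auto split: if_splits)
next
  case (Node i t0 t1)
  obtain j s0 s1 where t': "t' = Node j s0 s1"
    using Node.prems by (cases t') (auto split: if_splits)
  obtain x v where x: "encode_btree t0 = x # v" "x \<noteq> Tally"
    using encode_btree_Cons by blast
  obtain y w where y: "encode_btree s0 = y # w" "y \<noteq> Tally"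
    using encode_btree_Cons by blast
  have "replicate i Tally @ x # (v @ encode_btree t1 @ u) =
        replicate j Tally @ y # (w @ encode_btree s1 @ u')"
    using Node.prems x y t' by simp
  from replicate_Tally_append_eq[OF this x(2) y(2)]
  have "i = j" "encode_btree t0 @ (encode_btree t1 @ u) = encode_btree s0 @ (encode_btree s1 @ u')"
    using x y by auto
  then show ?case using Node.IH(1)[of _ s0] Node.IH(2)[of _ s1] t' by metis
qed

lemma encode_pinsts_eq:
  "concat (map (\<lambda>e. Sep # encode_pinst e) es) = concat (map (\<lambda>e. Sep # encode_pinst e) es') \<Longrightarrow>
   es = es'"
proof (induction es arbitrary: es')
  case Nil
  then show ?case by (cases es') auto
next
  case (Cons e es)
  let ?c = "\<lambda>es. concat (map (\<lambda>e. Sep # encode_pinst e) es)"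
  obtain d ds where es': "es' = d # ds" using Cons.prems by (cases es') auto
  have eq: "encode_pinst e @ ?c es = encode_pinst d @ ?c ds"
    using Cons.prems es' by simp
  have val: "encode_value a \<noteq> Sep" for a by (cases a) auto
  have tw: "takeWhile (\<lambda>x. x \<noteq> Sep) (encode_pinst e @ ?c es) = encode_pinst e" for e es
    by (cases es) (auto simp: encode_pinst_def val takeWhile_append)
  have pe: "encode_pinst e = encode_pinst d" using arg_cong[OF eq, of "takeWhile (\<lambda>x. x \<noteq> Sep)"] tw by simp
  have inj: "inj encode_value"
  proof (rule injI)
    fix a b assume "encode_value a = encode_value b"
    then show "a = b" by (cases a; cases b) (auto split: if_splits)
  qed
  have "e = d" using pe inj by (simp add: encode_pinst_def)
  moreover have "es = ds" using eq pe Cons.IH by simp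
  ultimately show ?case using es' by simp
qed

lemma encode_inject: "encode T es = encode T' es' \<longleftrightarrow> T = T' \<and> es = es'"
proof
  assume eq: "encode T es = encode T' es'"
  then have 1: "dt_dim T = dt_dim T'"
    and 2: "encode_btree (dt_tree T) @ concat (map (\<lambda>e. Sep # encode_pinst e) es) =
            encode_btree (dt_tree T') @ concat (map (\<lambda>e. Sep # encode_pinst e) es')"
    unfolding encode_def by (auto dest: replicate_Tally_append_eq)
  from encode_btree_append_eq[OF 2] encode_pinsts_eq 1 show "T = T' \<and> es = es'"
    by simp
qed simp

end

theory Submission
  imports Defs "HOL-Library.Countable"
begin

text \<open>
  Whether \<open>\<phi>\<close> holds of \<open>e\<^sub>1, \<dots>, e\<^sub>k\<close> depends only on how many coordinates \<open>i\<close> have a given column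
  \<open>(e\<^sub>1[i], \<dots>, e\<^sub>k[i])\<close>, since permuting the coordinates is an automorphism.  Quantifying over one
  more instance amounts to splitting each of these \<open>3\<^sup>k\<close> counts into three, so for fixed \<open>\<phi>\<close> the
  problem is expressible on the input word by Boolean operations and counting quantifiers over
  \<open>{0..length w}\<close>; so is the well-formedness of the input, a preorder encoding being recognised by
  comparing numbers of leaves and inner nodes in its prefixes.

  Such a predicate is evaluated by nested loops with finitely many heads on the read-only input.  A
  multi-tape machine gives each head its own copy of the input.  Its states in this phase are the
  residual programs.  There are polynomially many configurations and a halting deterministic run
  repeats none, so termination alone yields the time bound.
\<close>

section \<open>Multi-head programs\<close>

datatype 'a view = View (at_zero: bool) (at_end: bool) (letter: "'a option")

datatype 'a test =
    AtZero nat
  | AtEnd nat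
  | Letter 'a nat
  | TNot "'a test"
  | TAnd "'a test" "'a test"

datatype 'a com =
    Skip
  | Inc nat
  | Dec nat
  | Seq "'a com" "'a com"
  | Cond "'a test" "'a com" "'a com"
  | While "'a test" "'a com"

instance view :: (countable) countable by countable_datatype
instance test :: (countable) countable by countable_datatype
instance com :: (countable) countable by countable_datatype

text \<open>
  Heads move on the positions \<open>{0..Suc (length w)}\<close>, so that a head can hold the number of
  positions in \<open>{0..length w}\<close> with a given property.
\<close>

definition view :: "'a list \<Rightarrow> nat \<Rightarrow> 'a view" where
  "view w p = View (p = 0) (length w < p) (if p < length w then Some (w ! p) else None)"

lemma view_sel [simp]:
  "at_zero (view w p) \<longleftrightarrow> p = 0"
  "at_end (view w p) \<longleftrightarrow> length w < p"
  "letter (view w p) = Some a \<longleftrightarrow> p < length w \<and> w ! p = a"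
  by (auto simp: view_def)

fun test_holds :: "(nat \<Rightarrow> 'a view) \<Rightarrow> 'a test \<Rightarrow> bool" where
  "test_holds r (AtZero x) \<longleftrightarrow> at_zero (r x)"
| "test_holds r (AtEnd x) \<longleftrightarrow> at_end (r x)"
| "test_holds r (Letter a x) \<longleftrightarrow> letter (r x) = Some a"
| "test_holds r (TNot b) \<longleftrightarrow> \<not> test_holds r b"
| "test_holds r (TAnd b b') \<longleftrightarrow> test_holds r b \<and> test_holds r b'"

fun com_next :: "(nat \<Rightarrow> 'a view) \<Rightarrow> 'a com \<Rightarrow> 'a com \<times> (nat \<Rightarrow> move)" where
  "com_next r Skip = (Skip, \<lambda>_. Stay)"
| "com_next r (Inc x) = (Skip, (\<lambda>_. Stay)(x := if at_end (r x) then Stay else MoveRight))"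
| "com_next r (Dec x) = (Skip, (\<lambda>_. Stay)(x := if at_zero (r x) then Stay else MoveLeft))"
| "com_next r (Seq c d) =
     (if c = Skip then (d, \<lambda>_. Stay) else (Seq (fst (com_next r c)) d, snd (com_next r c)))"
| "com_next r (Cond b c d) = (if test_holds r b then c else d, \<lambda>_. Stay)"
| "com_next r (While b c) =
     (if test_holds r b then Seq c (While b c) else Skip, \<lambda>_. Stay)"

fun move_head :: "move \<Rightarrow> nat \<Rightarrow> nat" where
  "move_head MoveLeft p = p - 1"
| "move_head MoveRight p = Suc p"
| "move_head Stay p = p"

definition com_step :: "'a list \<Rightarrow> 'a com \<times> (nat \<Rightarrow> nat) \<Rightarrow> 'a com \<times> (nat \<Rightarrow> nat)" where
  "com_step w cs =
     (let (c', mv) = com_next (\<lambda>x. view w (snd cs x)) (fst cs)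
      in (c', \<lambda>x. move_head (mv x) (snd cs x)))"

abbreviation holds :: "'a list \<Rightarrow> 'a test \<Rightarrow> (nat \<Rightarrow> nat) \<Rightarrow> bool" where
  "holds w b s \<equiv> test_holds (\<lambda>x. view w (s x)) b"

lemma com_step_Skip [simp]: "com_step w (Skip, s) = (Skip, s)"
  by (simp add: com_step_def)

lemma com_step_Inc: "s x \<le> length w \<Longrightarrow> com_step w (Inc x, s) = (Skip, s(x := Suc (s x)))"
  by (auto simp: com_step_def fun_eq_iff)

lemma com_step_Dec: "com_step w (Dec x, s) = (Skip, s(x := s x - 1))"
  by (auto simp: com_step_def fun_eq_iff)

lemma com_step_Seq_Skip: "com_step w (Seq Skip d, s) = (d, s)"
  by (simp add: com_step_def)

lemma com_step_Seq:
  "c \<noteq> Skip \<Longrightarrow> com_step w (c, s) = (c', s') \<Longrightarrow> com_step w (Seq c d, s) = (Seq c' d, s')"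
  by (auto simp: com_step_def split: prod.splits)

lemma com_step_Cond: "com_step w (Cond b c d, s) = (if holds w b s then c else d, s)"
  by (simp add: com_step_def)

lemma com_step_While:
  "com_step w (While b c, s) = (if holds w b s then Seq c (While b c) else Skip, s)"
  by (simp add: com_step_def)

subsection \<open>Total correctness\<close>

definition wp :: "'a list \<Rightarrow> 'a com \<Rightarrow> ((nat \<Rightarrow> nat) \<Rightarrow> bool) \<Rightarrow> (nat \<Rightarrow> nat) \<Rightarrow> bool" where
  "wp w c Q s \<longleftrightarrow> (\<exists>t s'. (com_step w ^^ t) (c, s) = (Skip, s') \<and> Q s')"

lemma wp_first_halt:
  assumes "wp w c Q s"
  obtains t s' where "(com_step w ^^ t) (c, s) = (Skip, s')" "Q s'"
    "\<And>i. i < t \<Longrightarrow> fst ((com_step w ^^ i) (c, s)) \<noteq> Skip"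
proof -
  define halted where "halted t \<longleftrightarrow> fst ((com_step w ^^ t) (c, s)) = Skip" for t
  obtain u s' where halt: "(com_step w ^^ u) (c, s) = (Skip, s')" "Q s'"
    using assms unfolding wp_def by blast
  then have "halted u" by (simp add: halted_def)
  define t where "t = (LEAST t. halted t)"
  have "halted t" "t \<le> u"
    using \<open>halted u\<close> by (auto simp: t_def intro: LeastI Least_le)
  then obtain s'' where first: "(com_step w ^^ t) (c, s) = (Skip, s'')"
    unfolding halted_def by (metis prod.collapse)
  have "(com_step w ^^ i) (Skip, s'') = (Skip, s'')" for i by (induction i) auto
  then have "(com_step w ^^ (u - t + t)) (c, s) = (Skip, s'')"
    by (simp only: funpow_add comp_apply first)
  then have "s'' = s'" using halt(1) \<open>t \<le> u\<close> by simp
  moreover have "\<not> halted i" if "i < t" for i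
    using that not_less_Least unfolding t_def by blast
  ultimately show thesis using that[OF first] halt(2) by (simp add: halted_def)
qed

lemma wp_mono: "wp w c Q s \<Longrightarrow> (\<And>s'. Q s' \<Longrightarrow> R s') \<Longrightarrow> wp w c R s"
  unfolding wp_def by blast

lemma wp_Skip: "Q s \<Longrightarrow> wp w Skip Q s"
  unfolding wp_def by (intro exI[of _ 0]) auto

lemma wp_com_step:
  assumes "com_step w (c, s) = (c', s')" and "wp w c' Q s'"
  shows "wp w c Q s"
proof -
  obtain t s'' where "(com_step w ^^ t) (c', s') = (Skip, s'')" "Q s''"
    using assms(2) unfolding wp_def by blast
  then have "(com_step w ^^ Suc t) (c, s) = (Skip, s'')"
    using assms(1) by (simp only: funpow_Suc_right comp_apply)
  then show ?thesis using \<open>Q s''\<close> unfolding wp_def by blast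
qed

lemma wp_Inc: "s x \<le> length w \<Longrightarrow> Q (s(x := Suc (s x))) \<Longrightarrow> wp w (Inc x) Q s"
  by (rule wp_com_step[OF com_step_Inc wp_Skip])

lemma wp_Dec: "Q (s(x := s x - 1)) \<Longrightarrow> wp w (Dec x) Q s"
  by (rule wp_com_step[OF com_step_Dec wp_Skip])

lemma wp_Seq:
  assumes "wp w c (wp w d Q) s"
  shows "wp w (Seq c d) Q s"
proof -
  have "wp w (Seq c d) Q s" if "(com_step w ^^ t) (c, s) = (Skip, s')" "wp w d Q s'" for t s'
    using that
  proof (induction t arbitrary: c s)
    case 0
    then show ?case using wp_com_step[OF com_step_Seq_Skip] by simp
  next
    case (Suc t)
    show ?case
    proof (cases "c = Skip")
      case True
      then show ?thesis using Suc.IH[of Skip s] Suc.prems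
        by (simp only: funpow_Suc_right comp_apply com_step_Skip)
    next
      case False
      obtain c' s1 where step: "com_step w (c, s) = (c', s1)" by fastforce
      then have "wp w (Seq c' d) Q s1"
        using Suc by (simp only: funpow_Suc_right comp_apply)
      then show ?thesis using wp_com_step[OF com_step_Seq[OF False step]] by blast
    qed
  qed
  then show ?thesis using assms unfolding wp_def[of w c] by blast
qed

lemma wp_Cond:
  assumes "holds w b s \<Longrightarrow> wp w c Q s" and "\<not> holds w b s \<Longrightarrow> wp w d Q s"
  shows "wp w (Cond b c d) Q s"
  using assms by (intro wp_com_step[OF com_step_Cond]) simp

lemma wp_While:
  fixes \<mu> :: "(nat \<Rightarrow> nat) \<Rightarrow> nat"
  assumes body: "\<And>s. I s \<Longrightarrow> holds w b s \<Longrightarrow> wp w c (\<lambda>s'. I s' \<and> \<mu> s' < \<mu> s) s"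
    and "I s" and post: "\<And>s. I s \<Longrightarrow> \<not> holds w b s \<Longrightarrow> Q s"
  shows "wp w (While b c) Q s"
  using \<open>I s\<close>
proof (induction "\<mu> s" arbitrary: s rule: less_induct)
  case less
  show ?case
  proof (cases "holds w b s")
    case True
    have "wp w (Seq c (While b c)) Q s"
      by (intro wp_Seq wp_mono[OF body[OF less.prems True]]) (use less.hyps in blast)
    then show ?thesis using True by (intro wp_com_step[OF com_step_While]) simp
  next
    case False
    then show ?thesis using post[OF less.prems]
      by (intro wp_com_step[OF com_step_While]) (simp add: wp_Skip)
  qed
qed

subsection \<open>Residual programs and the heads of a program\<close>

fun residuals :: "'a com \<Rightarrow> 'a com set" where
  "residuals Skip = {Skip}"
| "residuals (Inc x) = {Inc x, Skip}"
| "residuals (Dec x) = {Dec x, Skip}"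
| "residuals (Seq c d) = (\<lambda>c'. Seq c' d) ` residuals c \<union> residuals d"
| "residuals (Cond b c d) = insert (Cond b c d) (residuals c \<union> residuals d)"
| "residuals (While b c) =
     insert (While b c) (insert Skip ((\<lambda>c'. Seq c' (While b c)) ` residuals c))"

lemma finite_residuals [simp]: "finite (residuals c)"
  by (induction c) auto

lemma self_in_residuals [simp]: "c \<in> residuals c"
  by (induction c) auto

lemma com_next_in_residuals: "d \<in> residuals c \<Longrightarrow> fst (com_next r d) \<in> residuals c"
  by (induction c arbitrary: d) (auto split: if_splits)

fun test_heads :: "'a test \<Rightarrow> nat set" where
  "test_heads (AtZero x) = {x}"
| "test_heads (AtEnd x) = {x}"
| "test_heads (Letter a x) = {x}"
| "test_heads (TNot b) = test_heads b"
| "test_heads (TAnd b b') = test_heads b \<union> test_heads b'"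

fun heads :: "'a com \<Rightarrow> nat set" where
  "heads Skip = {}"
| "heads (Inc x) = {x}"
| "heads (Dec x) = {x}"
| "heads (Seq c d) = heads c \<union> heads d"
| "heads (Cond b c d) = test_heads b \<union> heads c \<union> heads d"
| "heads (While b c) = test_heads b \<union> heads c"

lemma finite_test_heads [simp]: "finite (test_heads b)"
  by (induction b) auto

lemma finite_heads: "finite (heads c)"
  by (induction c) auto

lemma heads_residuals: "d \<in> residuals c \<Longrightarrow> heads d \<subseteq> heads c"
  by (induction c arbitrary: d) fastforce+

lemma test_holds_cong:
  "(\<And>x. x \<in> test_heads b \<Longrightarrow> r x = r' x) \<Longrightarrow> test_holds r b = test_holds r' b"
  by (induction b) auto

lemma com_next_cong: "(\<And>x. x \<in> heads c \<Longrightarrow> r x = r' x) \<Longrightarrow> com_next r c = com_next r' c"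
proof (induction c)
  case (Cond b c d)
  then show ?case using test_holds_cong[of b r r'] by simp
next
  case (While b c)
  then show ?case using test_holds_cong[of b r r'] by simp
qed auto

section \<open>Simulation by Turing machines\<close>

datatype 'a phase = Accept | Reject | Copy bool | Finish | Rewind | Run "'a com"

instance phase :: (countable) countable by countable_datatype

instance view :: (finite) finite
proof
  have "UNIV = (\<lambda>(z, e, a). View z e a) ` (UNIV :: (bool \<times> bool \<times> 'a option) set)"
    by (auto simp: image_iff) (metis view.exhaust)
  then show "finite (UNIV :: 'a view set)" by (metis finite finite_imageI)
qed

definition mark :: "'a::finite view \<Rightarrow> 'a cell" where
  "mark v = Work (to_nat v)"

fun unmark :: "'a::finite cell \<Rightarrow> 'a view" where
  "unmark (Work k) = from_nat k"
| "unmark _ = undefined"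

lemma unmark_mark [simp]: "unmark (mark v) = v"
  by (simp add: mark_def)

text \<open>
  The phases before \<^term>\<open>Run c\<close> replace every tape by the word of views of the input.  The input
  is accepted if head \<open>f\<close> of the program \<open>c\<close> is not at position 0 in the end.
\<close>

fun sim_next ::
  "nat \<Rightarrow> 'a::finite com \<Rightarrow> nat \<Rightarrow> 'a phase \<Rightarrow> 'a cell list \<Rightarrow> 'a phase \<times> ('a cell \<times> move) list"
where
  "sim_next k c f (Copy first) ss =
     (case hd ss of
        Input a \<Rightarrow> (Copy False, replicate k (mark (View first False (Some a)), MoveRight))
      | _ \<Rightarrow> (Finish, replicate k (mark (View first False None), MoveRight)))"
| "sim_next k c f Finish ss = (Rewind, replicate k (mark (View False True None), Stay))"
| "sim_next k c f Rewind ss =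
     (if at_zero (unmark (hd ss)) then (Run c, map (\<lambda>a. (a, Stay)) ss)
      else (Rewind, map (\<lambda>a. (a, MoveLeft)) ss))"
| "sim_next k c f (Run d) ss =
     (if d = Skip then
        (if at_zero (unmark (ss ! f)) then Reject else Accept, map (\<lambda>a. (a, Stay)) ss)
      else (let (d', mv) = com_next (\<lambda>x. unmark (ss ! x)) d
            in (Run d', map (\<lambda>x. (ss ! x, mv x)) [0..<k])))"
| "sim_next k c f p ss = (p, map (\<lambda>a. (a, Stay)) ss)"

definition sim_phases :: "'a com \<Rightarrow> 'a phase set" where
  "sim_phases c = {Accept, Reject, Copy True, Copy False, Finish, Rewind} \<union> Run ` residuals c"

definition sim_alphabet :: "'a::finite cell set" where
  "sim_alphabet = insert Blank (range Input \<union> range mark)"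

definition sim :: "nat \<Rightarrow> 'a::finite com \<Rightarrow> nat \<Rightarrow> 'a tm" where
  "sim k c f =
     \<lparr>tm_tapes = k, tm_states = to_nat ` sim_phases c, tm_alphabet = sim_alphabet,
      tm_start = to_nat (Copy True :: 'a phase), tm_accept = to_nat (Accept :: 'a phase),
      tm_reject = to_nat (Reject :: 'a phase),
      tm_delta = (\<lambda>q ss. map_prod to_nat id (sim_next k c f (from_nat q) ss))\<rparr>"

lemma sim_next_closed:
  assumes "0 < k" "p \<in> sim_phases c" "length ss = k" "set ss \<subseteq> sim_alphabet"
  shows "fst (sim_next k c f p ss) \<in> sim_phases c \<and> length (snd (sim_next k c f p ss)) = k \<and>
    fst ` set (snd (sim_next k c f p ss)) \<subseteq> sim_alphabet"
proof (cases p)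
  case (Copy first)
  then show ?thesis using assms(1)
    by (cases "hd ss") (auto simp: sim_phases_def sim_alphabet_def)
next
  case Finish
  then show ?thesis using assms(1) by (auto simp: sim_phases_def sim_alphabet_def)
next
  case Rewind
  then show ?thesis using assms by (auto simp: sim_phases_def)
next
  case (Run d)
  then have "d \<in> residuals c" using assms(2) by (auto simp: sim_phases_def)
  moreover have "ss ! x \<in> sim_alphabet" if "x < k" for x using assms(3,4) that by auto
  ultimately show ?thesis
    using Run assms(3,4) com_next_in_residuals[of d c]
    by (auto simp: sim_phases_def split: prod.split) (metis fst_conv image_eqI)+
qed (use assms in \<open>auto simp: sim_phases_def\<close>)

lemma turing_machine_sim:
  fixes c :: "'a::finite com"
  assumes "0 < k"
  shows "turing_machine (sim k c f)"
proof -
  let ?M = "sim k c f"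
  have "fst (tm_delta ?M q ss) \<in> tm_states ?M \<and> length (snd (tm_delta ?M q ss)) = k \<and>
      fst ` set (snd (tm_delta ?M q ss)) \<subseteq> tm_alphabet ?M"
    if "q \<in> tm_states ?M" and read: "length ss = k" "set ss \<subseteq> tm_alphabet ?M" for q ss
  proof -
    obtain p where "p \<in> sim_phases c" "q = to_nat p"
      using \<open>q \<in> _\<close> by (auto simp: sim_def)
    then show ?thesis using sim_next_closed[OF assms, of p c ss f] read by (simp add: sim_def)
  qed
  moreover have "finite (tm_states ?M)" "finite (tm_alphabet ?M)"
    by (simp_all add: sim_def sim_phases_def sim_alphabet_def)
  moreover have "insert Blank (range Input) \<subseteq> tm_alphabet ?M"
    by (auto simp: sim_def sim_alphabet_def)
  moreover have "{tm_start ?M, tm_accept ?M, tm_reject ?M} \<subseteq> tm_states ?M"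
    by (simp add: sim_def sim_phases_def)
  moreover have "tm_accept ?M \<noteq> tm_reject ?M" "tm_tapes ?M = k" by (simp_all add: sim_def)
  ultimately show ?thesis using assms unfolding turing_machine_def by simp
qed

definition sim_conf :: "'a::finite phase \<Rightarrow> 'a tape list \<Rightarrow> 'a config" where
  "sim_conf p tps = (to_nat p, tps)"

lemma tm_step_sim:
  assumes "p \<noteq> Accept" "p \<noteq> Reject"
  shows "tm_step (sim k c f) (sim_conf p tps) =
    (let (p', acts) = sim_next k c f p (map tape_read tps) in sim_conf p' (map2 tape_act acts tps))"
  using assms by (simp add: tm_step_def sim_def sim_conf_def map_prod_def split: prod.split)

subsection \<open>Running the program\<close>

definition view_tape :: "'a::finite list \<Rightarrow> int \<Rightarrow> 'a cell" where
  "view_tape w i = (if 0 \<le> i \<and> i \<le> int (Suc (length w)) then mark (view w (nat i)) else Blank)"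

lemma view_tape_int [simp]: "p \<le> Suc (length w) \<Longrightarrow> view_tape w (int p) = mark (view w p)"
  by (simp add: view_tape_def)

definition run_conf :: "nat \<Rightarrow> 'a::finite list \<Rightarrow> 'a com \<times> (nat \<Rightarrow> nat) \<Rightarrow> 'a config" where
  "run_conf k w cs = sim_conf (Run (fst cs)) (map (\<lambda>x. (view_tape w, int (snd cs x))) [0..<k])"

definition run_states :: "'a list \<Rightarrow> 'a com \<Rightarrow> ('a com \<times> (nat \<Rightarrow> nat)) set" where
  "run_states w c = residuals c \<times> {s. \<forall>x. s x \<le> Suc (length w)}"

lemma com_next_move:
  "snd (com_next r c) x = MoveLeft \<Longrightarrow> \<not> at_zero (r x)"
  "snd (com_next r c) x = MoveRight \<Longrightarrow> \<not> at_end (r x)"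
  by (induction c) (auto split: if_splits)

lemma com_step_in_run_states:
  assumes "cs \<in> run_states w c"
  shows "com_step w cs \<in> run_states w c"
proof -
  let ?r = "\<lambda>x. view w (snd cs x)"
  have "move_head (snd (com_next ?r (fst cs)) x) (snd cs x) \<le> Suc (length w)" for x
    using assms com_next_move(2)[of ?r "fst cs" x]
    by (cases "snd (com_next ?r (fst cs)) x") (auto simp: run_states_def le_SucI le_diff_conv)
  then show ?thesis
    using assms com_next_in_residuals[of "fst cs" c ?r]
    by (auto simp: run_states_def com_step_def split: prod.split)
qed

lemma int_move_head:
  "(m = MoveLeft \<Longrightarrow> p \<noteq> 0) \<Longrightarrow> int (move_head m p) = int p + head_shift m"
  by (cases m) auto

lemma tm_step_run_conf:
  assumes "cs \<in> run_states w c" "heads c \<subseteq> {..<k}" "fst cs \<noteq> Skip"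
  shows "tm_step (sim k c f) (run_conf k w cs) = run_conf k w (com_step w cs)"
proof -
  obtain d s where cs: "cs = (d, s)" by fastforce
  let ?tps = "map (\<lambda>x. (view_tape w, int (s x))) [0..<k]"
  have in_range: "s x \<le> Suc (length w)" for x
    using assms(1) by (simp add: cs run_states_def)
  have "heads d \<subseteq> {..<k}"
    using assms(1,2) heads_residuals[of d c] by (auto simp: cs run_states_def)
  then have "com_next (\<lambda>x. unmark (map tape_read ?tps ! x)) d = com_next (\<lambda>x. view w (s x)) d"
    using in_range by (intro com_next_cong) (auto simp: tape_read_def)
  moreover obtain d' mv where next_d: "com_next (\<lambda>x. view w (s x)) d = (d', mv)" by fastforce
  ultimately have "tm_step (sim k c f) (run_conf k w cs) =
      sim_conf (Run d') (map2 tape_act (map (\<lambda>x. (map tape_read ?tps ! x, mv x)) [0..<k]) ?tps)"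
    using assms(3) by (simp add: run_conf_def cs tm_step_sim)
  also have "map2 tape_act (map (\<lambda>x. (map tape_read ?tps ! x, mv x)) [0..<k]) ?tps =
      map (\<lambda>x. (view_tape w, int (move_head (mv x) (s x)))) [0..<k]"
    using com_next_move(1)[of "\<lambda>x. view w (s x)" d] next_d
    by (intro nth_equalityI) (auto simp: tape_read_def int_move_head)
  finally show ?thesis by (simp add: run_conf_def cs com_step_def next_d)
qed

lemma funpow_tm_step_run_conf:
  assumes "cs \<in> run_states w c" "heads c \<subseteq> {..<k}"
    and "\<And>i. i < t \<Longrightarrow> fst ((com_step w ^^ i) cs) \<noteq> Skip"
  shows "(tm_step (sim k c f) ^^ t) (run_conf k w cs) = run_conf k w ((com_step w ^^ t) cs) \<and>
    (com_step w ^^ t) cs \<in> run_states w c"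
  using assms(3)
proof (induction t)
  case (Suc t)
  then show ?case
    using tm_step_run_conf[OF _ assms(2)] com_step_in_run_states[of "(com_step w ^^ t) cs" w c]
    by simp
qed (simp add: assms(1))

lemma finite_card_run_conf:
  "finite (run_conf k w ` run_states w c)"
  "card (run_conf k w ` run_states w c) \<le> card (residuals c) * (length w + 2) ^ k"
proof -
  let ?L = "{ps. set ps \<subseteq> {..Suc (length w)} \<and> length ps = k}"
  let ?g = "\<lambda>(d, ps). sim_conf (Run d) (map (\<lambda>p. (view_tape w, int p)) ps)"
  have subset: "run_conf k w ` run_states w c \<subseteq> ?g ` (residuals c \<times> ?L)"
  proof
    fix z assume "z \<in> run_conf k w ` run_states w c"
    then obtain d s where "(d, s) \<in> run_states w c" "z = run_conf k w (d, s)" by auto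
    then have "z = ?g (d, map s [0..<k])" "(d, map s [0..<k]) \<in> residuals c \<times> ?L"
      by (auto simp: run_conf_def run_states_def comp_def)
    then show "z \<in> ?g ` (residuals c \<times> ?L)" by blast
  qed
  have finite: "finite (residuals c \<times> ?L)"
    by (intro finite_cartesian_product finite_residuals finite_lists_length_eq) simp
  then show "finite (run_conf k w ` run_states w c)" using finite_subset[OF subset] by blast
  have "card (run_conf k w ` run_states w c) \<le> card (residuals c \<times> ?L)"
    using card_mono[OF _ subset] card_image_le[OF finite, of ?g] finite by fastforce
  then show "card (run_conf k w ` run_states w c) \<le> card (residuals c) * (length w + 2) ^ k"
    by (simp add: card_cartesian_product card_lists_length_eq)
qed

lemma funpow_reach_before_card:
  fixes f :: "'b \<Rightarrow> 'b"
  assumes "(f ^^ t) x = y" "\<And>i. i \<le> t \<Longrightarrow> (f ^^ i) x \<in> S" "finite S"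
  shows "\<exists>i < card S. (f ^^ i) x = y"
proof -
  define l where "l = (LEAST i. (f ^^ i) x = y)"
  have first: "(f ^^ l) x = y" "l \<le> t" and least: "\<And>i. (f ^^ i) x = y \<Longrightarrow> l \<le> i"
    unfolding l_def using assms(1) by (auto intro: LeastI Least_le)
  have no_repetition: False if "i < j" "j \<le> l" "(f ^^ i) x = (f ^^ j) x" for i j
  proof -
    have "(f ^^ (l - j + i)) x = (f ^^ (l - j + j)) x"
      by (simp only: funpow_add comp_apply that(3))
    then have "l \<le> l - j + i" using that(2) first(1) by (intro least) simp
    then show False using that by simp
  qed
  have "inj_on (\<lambda>i. (f ^^ i) x) {..l}"
    by (rule linorder_inj_onI) (use no_repetition in auto)
  then have "card {..l} \<le> card S"
    using assms(2,3) first(2) by (intro card_inj_on_le) auto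
  then have "l < card S" by simp
  then show ?thesis using first(1) by blast
qed

subsection \<open>Preparing the tapes\<close>

definition copy_conf :: "nat \<Rightarrow> 'a::finite list \<Rightarrow> nat \<Rightarrow> 'a config" where
  "copy_conf k w i =
     sim_conf (if i \<le> length w then Copy (i = 0) else Finish)
       (map (\<lambda>x. (\<lambda>p. if 0 \<le> p \<and> p < int i then view_tape w p
                     else if x = 0 then fst (input_tape w) p else Blank, int i)) [0..<k])"

lemma tm_initial_sim:
  assumes "0 < k"
  shows "tm_initial (sim k c f) w = copy_conf k w 0"
proof -
  have "input_tape w # replicate (k - 1) blank_tape =
      map (\<lambda>x. (\<lambda>p. if x = 0 then fst (input_tape w) p else Blank, 0)) [0..<k]"
    using assms by (intro nth_equalityI) (auto simp: nth_Cons' input_tape_def blank_tape_def)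
  then show ?thesis
    by (auto simp: tm_initial_def copy_conf_def sim_conf_def sim_def fun_eq_iff)
qed

lemma tm_step_copy_conf:
  assumes "0 < k" "i \<le> length w"
  shows "tm_step (sim k c f) (copy_conf k w i) = copy_conf k w (Suc i)"
proof -
  define tps where "tps = snd (copy_conf k w i)"
  have conf: "copy_conf k w i = sim_conf (Copy (i = 0)) tps"
    using assms(2) by (simp add: tps_def copy_conf_def sim_conf_def)
  have "hd (map tape_read tps) = (if i < length w then Input (w ! i) else Blank)"
    using assms
    by (simp add: tps_def copy_conf_def sim_conf_def hd_map tape_read_def input_tape_def)
  then have "sim_next k c f (Copy (i = 0)) (map tape_read tps) =
      (if i < length w then Copy False else Finish, replicate k (view_tape w (int i), MoveRight))"
    using assms(2) by (simp add: view_def)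
  then have "tm_step (sim k c f) (copy_conf k w i) =
      sim_conf (if i < length w then Copy False else Finish)
        (map2 tape_act (replicate k (view_tape w (int i), MoveRight)) tps)"
    unfolding conf by (simp add: tm_step_sim del: sim_next.simps)
  also have "map2 tape_act (replicate k (view_tape w (int i), MoveRight)) tps =
      snd (copy_conf k w (Suc i))"
    by (intro nth_equalityI) (auto simp: tps_def copy_conf_def sim_conf_def fun_eq_iff)
  finally show ?thesis by (auto simp: copy_conf_def sim_conf_def)
qed

definition rewind_conf :: "nat \<Rightarrow> 'a::finite list \<Rightarrow> nat \<Rightarrow> 'a config" where
  "rewind_conf k w i = sim_conf Rewind (map (\<lambda>_. (view_tape w, int i)) [0..<k])"

lemma tm_step_copy_conf_end:
  "tm_step (sim k c f) (copy_conf k w (Suc (length w))) = rewind_conf k w (Suc (length w))"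
proof -
  have "map2 tape_act (replicate k (mark (View False True None), Stay))
          (snd (copy_conf k w (Suc (length w)))) = snd (rewind_conf k w (Suc (length w)))"
    by (intro nth_equalityI)
      (auto simp: copy_conf_def rewind_conf_def sim_conf_def fun_eq_iff view_tape_def
        input_tape_def view_def nat_add_distrib)
  then show ?thesis
    by (simp add: rewind_conf_def copy_conf_def tm_step_sim) (simp add: sim_conf_def)
qed

lemma tm_step_rewind_conf:
  assumes "0 < k" "i \<le> Suc (length w)"
  shows "tm_step (sim k c f) (rewind_conf k w i) =
     (if i = 0 then run_conf k w (c, \<lambda>_. 0) else rewind_conf k w (i - 1))"
proof -
  let ?tps = "map (\<lambda>_. (view_tape w, int i)) [0..<k]"
  have "at_zero (unmark (hd (map tape_read ?tps))) \<longleftrightarrow> i = 0"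
    using assms by (simp add: hd_map tape_read_def)
  moreover have "map2 tape_act (map (\<lambda>a. (a, m)) (map tape_read ?tps)) ?tps =
      map (\<lambda>_. (view_tape w, int i + head_shift m)) [0..<k]" for m
    by (intro nth_equalityI) (auto simp: tape_read_def)
  ultimately show ?thesis
    by (auto simp: rewind_conf_def run_conf_def tm_step_sim of_nat_diff simp del: map_map)
qed

lemma funpow_tm_step_initial:
  fixes w :: "'a::finite list"
  assumes "0 < k"
  shows "(tm_step (sim k c f) ^^ (2 * length w + 4)) (tm_initial (sim k c f) w) =
    run_conf k w (c, \<lambda>_. 0)"
proof -
  let ?step = "tm_step (sim k c f)" and ?e = "Suc (length w)"
  have copying: "(?step ^^ i) (tm_initial (sim k c f) w) = copy_conf k w i" if "i \<le> ?e" for i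
    using that by (induction i) (simp_all add: tm_initial_sim tm_step_copy_conf assms)
  have copied: "(?step ^^ Suc ?e) (tm_initial (sim k c f) w) = rewind_conf k w ?e"
    unfolding funpow.simps(2)[of ?e] comp_apply copying[OF order_refl]
    by (rule tm_step_copy_conf_end)
  have rewound: "(?step ^^ Suc i) (rewind_conf k w i) = run_conf k w (c, \<lambda>_. 0)" if "i \<le> ?e" for i
    using that
  proof (induction i)
    case (Suc i)
    then show ?case
      using tm_step_rewind_conf[OF assms Suc.prems] by (subst funpow_Suc_right) simp
  qed (simp add: tm_step_rewind_conf assms)
  have "2 * length w + 4 = Suc ?e + Suc ?e" by simp
  then show ?thesis
    by (simp only: funpow_add comp_apply copied rewound[OF order_refl])
qed

lemma tm_step_run_conf_Skip:
  assumes "f < k" "s f \<le> Suc (length w)"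
  shows "fst (tm_step (sim k c f) (run_conf k w (Skip, s))) =
    (if s f = 0 then tm_reject (sim k c f) else tm_accept (sim k c f))"
proof -
  have "at_zero (unmark (map tape_read (map (\<lambda>x. (view_tape w, int (s x))) [0..<k]) ! f)) \<longleftrightarrow> s f = 0"
    using assms by (simp add: tape_read_def)
  then show ?thesis
    by (simp add: run_conf_def tm_step_sim del: map_map) (simp add: sim_conf_def sim_def)
qed

lemma sim_halts_in_time:
  fixes w :: "'a::finite list"
  assumes heads: "heads c \<subseteq> {..<k}" "f < k" and program: "wp w c (\<lambda>s. s f \<noteq> 0 \<longleftrightarrow> b) (\<lambda>_. 0)"
  shows "\<exists>t \<le> card (residuals c) * (length w + 2) ^ k + (2 * length w + 4).
    fst ((tm_step (sim k c f) ^^ t) (tm_initial (sim k c f) w)) =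
      (if b then tm_accept (sim k c f) else tm_reject (sim k c f))"
proof -
  let ?step = "tm_step (sim k c f)" and ?start = "(c, \<lambda>_. 0 :: nat)"
  have start: "?start \<in> run_states w c" by (simp add: run_states_def)
  obtain t s where halt: "(com_step w ^^ t) ?start = (Skip, s)" "s f \<noteq> 0 \<longleftrightarrow> b"
    and least: "\<And>i. i < t \<Longrightarrow> fst ((com_step w ^^ i) ?start) \<noteq> Skip"
    using wp_first_halt[OF program] by metis
  have run: "(?step ^^ i) (run_conf k w ?start) = run_conf k w ((com_step w ^^ i) ?start)"
      "(com_step w ^^ i) ?start \<in> run_states w c" if "i \<le> t" for i
    using funpow_tm_step_run_conf[OF start heads(1), of i f] least that by auto
  obtain i where reach: "i < card (run_conf k w ` run_states w c)"
      "(?step ^^ i) (run_conf k w ?start) = run_conf k w (Skip, s)"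
    using funpow_reach_before_card[of t ?step "run_conf k w ?start" _
        "run_conf k w ` run_states w c"]
      run halt(1) finite_card_run_conf(1)[of k w c] by (metis image_eqI order_refl)
  have "(?step ^^ (Suc i + (2 * length w + 4))) (tm_initial (sim k c f) w) =
      ?step (run_conf k w (Skip, s))"
    by (simp only: funpow_add[of "Suc i"] comp_apply funpow.simps(2) reach(2)
        funpow_tm_step_initial[OF order.strict_trans1[OF le0 heads(2)]])
  moreover have "s f \<le> Suc (length w)" using run(2)[of t] halt(1) by (auto simp: run_states_def)
  moreover have "Suc i \<le> card (residuals c) * (length w + 2) ^ k"
    using reach(1) finite_card_run_conf(2)[of k w c] by linarith
  ultimately show ?thesis
    using tm_step_run_conf_Skip[OF heads(2), of s w c] halt(2)
    by (intro exI[of _ "Suc i + (2 * length w + 4)"]) auto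
qed

theorem program_in_PTIME:
  fixes A :: "'a::finite list set"
  assumes "\<And>w. wp w c (\<lambda>s. s f \<noteq> 0 \<longleftrightarrow> w \<in> A) (\<lambda>_. 0)"
  shows "A \<in> PTIME"
proof -
  obtain k where heads: "insert f (heads c) \<subseteq> {..<k}"
    using finite_nat_iff_bounded[of "insert f (heads c)"] finite_heads by auto
  let ?p = "smult (card (residuals c)) ([:2, 1:] ^ k) + [:4, 2:] :: nat poly"
  have "poly ?p n = card (residuals c) * (n + 2) ^ k + (2 * n + 4)" for n
    by (simp add: add.commute mult.commute)
  then have "decides_in_time (sim k c f) A (poly ?p)"
    using sim_halts_in_time[of c k f] heads assms
    unfolding decides_in_time_def by (simp only: insert_subset lessThan_iff) blast
  moreover have "turing_machine (sim k c f)" using heads by (intro turing_machine_sim) auto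
  ultimately show ?thesis unfolding PTIME_def by blast
qed

section \<open>Decidable predicates\<close>

subsection \<open>Comparing and counting with heads\<close>

definition zero :: "nat \<Rightarrow> 'a com" where
  "zero x = While (TNot (AtZero x)) (Dec x)"

lemma wp_zero:
  assumes "Q (s(x := 0))"
  shows "wp w (zero x) Q s"
  unfolding zero_def
proof (rule wp_While[where I = "\<lambda>s'. s'(x := 0) = s(x := 0)" and \<mu> = "\<lambda>s'. s' x"])
  fix s'
  assume "s'(x := 0) = s(x := 0)" "\<not> holds w (TNot (AtZero x)) s'"
  then have "s' = s(x := 0)" by (metis fun_upd_triv test_holds.simps(1,4) view_sel(1))
  then show "Q s'" using assms by simp
qed (auto intro: wp_Dec)

definition negate :: "nat \<Rightarrow> 'a com" where
  "negate m = Cond (AtZero m) (Inc m) (zero m)"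

lemma wp_negate: "Q (s(m := of_bool (s m = 0))) \<Longrightarrow> wp w (negate m) Q s"
  unfolding negate_def by (intro wp_Cond wp_Inc wp_zero) auto

definition less_prog :: "nat \<Rightarrow> nat \<Rightarrow> nat \<Rightarrow> 'a com" where
  "less_prog x y m =
     Seq (zero m)
    (Seq (zero (Suc m))
    (Seq (While (TAnd (TNot (AtZero x)) (TNot (AtZero y)))
            (Seq (Dec x) (Seq (Dec y) (Inc (Suc m)))))
    (Seq (Cond (AtZero y) Skip (Inc m))
         (While (TNot (AtZero (Suc m))) (Seq (Dec (Suc m)) (Seq (Inc x) (Inc y)))))))"

definition returns :: "nat \<Rightarrow> bool \<Rightarrow> (nat \<Rightarrow> nat) \<Rightarrow> (nat \<Rightarrow> nat) \<Rightarrow> bool" where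
  "returns m b s s' \<longleftrightarrow> (\<forall>x < m. s' x = s x) \<and> s' m = of_bool b"

lemma wp_less_prog:
  assumes "x \<noteq> y" "x < m" "y < m" "s x \<le> length w" "s y \<le> length w"
  shows "wp w (less_prog x y m) (returns m (s x < s y) s) s"
proof -
  define invar where "invar b s' \<longleftrightarrow> (\<forall>z < m. z \<noteq> x \<longrightarrow> z \<noteq> y \<longrightarrow> s' z = s z) \<and>
      s' x + s' (Suc m) = s x \<and> s' y + s' (Suc m) = s y \<and> s' m = of_bool b" for b s'
  have subtract: "wp w (While (TAnd (TNot (AtZero x)) (TNot (AtZero y)))
        (Seq (Dec x) (Seq (Dec y) (Inc (Suc m))))) (\<lambda>s'. invar False s' \<and> (s' x = 0 \<or> s' y = 0)) s1"
    if "invar False s1" for s1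
  proof (rule wp_While[where I = "invar False" and \<mu> = "\<lambda>s'. s' x", OF _ that])
    show "wp w (Seq (Dec x) (Seq (Dec y) (Inc (Suc m)))) (\<lambda>s'. invar False s' \<and> s' x < s1 x) s1"
      if "invar False s1" "holds w (TAnd (TNot (AtZero x)) (TNot (AtZero y))) s1" for s1
      using that assms by (intro wp_Seq wp_Dec wp_Inc) (auto simp: invar_def)
  qed auto
  have restore: "wp w (While (TNot (AtZero (Suc m))) (Seq (Dec (Suc m)) (Seq (Inc x) (Inc y))))
      (returns m b s) s1" if "invar b s1" for b s1
  proof (rule wp_While[where I = "invar b" and \<mu> = "\<lambda>s'. s' (Suc m)", OF _ that])
    show "wp w (Seq (Dec (Suc m)) (Seq (Inc x) (Inc y)))
        (\<lambda>s'. invar b s' \<and> s' (Suc m) < s1 (Suc m)) s1"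
      if "invar b s1" "holds w (TNot (AtZero (Suc m))) s1" for s1
      using that assms by (intro wp_Seq wp_Dec wp_Inc) (auto simp: invar_def)
  qed (auto simp: invar_def returns_def)
  show ?thesis
    unfolding less_prog_def
  proof (intro wp_Seq wp_zero wp_mono[OF subtract])
    show "invar False (s(m := 0, Suc m := 0))" using assms by (simp add: invar_def)
  next
    fix s1
    assume "invar False s1 \<and> (s1 x = 0 \<or> s1 y = 0)"
    then have "if s1 y = 0 then \<not> s x < s y \<and> invar (s x < s y) s1
        else s x < s y \<and> s1 m \<le> length w \<and> invar (s x < s y) (s1(m := Suc (s1 m)))"
      using assms(2,3) by (auto simp: invar_def)
    then show "wp w (Cond (AtZero y) Skip (Inc m))
        (wp w (While (TNot (AtZero (Suc m))) (Seq (Dec (Suc m)) (Seq (Inc x) (Inc y))))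
          (returns m (s x < s y) s)) s1"
      by (intro wp_Cond wp_Skip wp_Inc restore) auto
  qed
qed

definition for_prog :: "nat \<Rightarrow> 'a com \<Rightarrow> 'a com" where
  "for_prog x c = Seq (zero x) (While (TNot (AtEnd x)) (Seq c (Inc x)))"

lemma wp_for_prog:
  assumes "invar 0 (s(x := 0))"
    and body: "\<And>s'. invar (s' x) s' \<Longrightarrow> s' x \<le> length w \<Longrightarrow>
      wp w c (\<lambda>s''. s'' x = s' x \<and> invar (Suc (s' x)) (s''(x := Suc (s' x)))) s'"
    and post: "\<And>s'. invar (Suc (length w)) s' \<Longrightarrow> Q s'"
  shows "wp w (for_prog x c) Q s"
  unfolding for_prog_def
proof (intro wp_Seq[of _ "zero x"] wp_zero wp_While[where
      I = "\<lambda>s'. s' x \<le> Suc (length w) \<and> invar (s' x) s'" and \<mu> = "\<lambda>s'. Suc (length w) - s' x"])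
  show "(s(x := 0)) x \<le> Suc (length w) \<and> invar ((s(x := 0)) x) (s(x := 0))"
    using assms(1) by simp
next
  fix s'
  assume invar: "s' x \<le> Suc (length w) \<and> invar (s' x) s'" and "holds w (TNot (AtEnd x)) s'"
  then have "s' x \<le> length w" by simp
  then show "wp w (Seq c (Inc x)) (\<lambda>s''. (s'' x \<le> Suc (length w) \<and> invar (s'' x) s'') \<and>
      Suc (length w) - s'' x < Suc (length w) - s' x) s'"
    using invar by (intro wp_Seq wp_mono[OF body] wp_Inc) auto
next
  fix s'
  assume "s' x \<le> Suc (length w) \<and> invar (s' x) s'" "\<not> holds w (TNot (AtEnd x)) s'"
  then have "s' x = Suc (length w)" "invar (s' x) s'" by auto
  then show "Q s'" by (intro post) simp
qed

lemma card_Collect_less_le: "card {j. j < i \<and> P j} \<le> (i :: nat)"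
  using card_mono[of "{..<i}" "{j. j < i \<and> P j}"] by auto

lemma card_Collect_less_Suc:
  "card {j. j < Suc i \<and> P j} = card {j. j < i \<and> P j} + of_bool (P i)"
proof -
  have "{j. j < Suc i \<and> P j} = {j. j < i \<and> P j} \<union> (if P i then {i} else {})"
    by (auto simp: less_Suc_eq)
  then show ?thesis by (auto simp: card_insert_if)
qed

lemma wp_for_prog_count:
  fixes g :: "nat \<Rightarrow> nat"
  assumes test: "\<And>s'. \<forall>y < m. s' y = s y \<Longrightarrow> s' (Suc m) \<le> length w \<Longrightarrow>
      wp w c (returns (m + 2) (P (s' (Suc m))) s') s'"
    and update: "\<And>s' i Q. i \<le> length w \<Longrightarrow> s' m = (g ^^ i) (s m) \<Longrightarrow> Q (s'(m := g (s' m))) \<Longrightarrow>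
      wp w d Q s'"
    and post: "\<And>s'. \<forall>y < m. s' y = s y \<Longrightarrow>
      s' m = (g ^^ card {i. i \<le> length w \<and> P i}) (s m) \<Longrightarrow> Q s'"
  shows "wp w (for_prog (Suc m) (Seq c (Cond (AtZero (m + 2)) Skip d))) Q s"
proof (rule wp_for_prog[where
      invar = "\<lambda>i s'. (\<forall>y < m. s' y = s y) \<and> s' m = (g ^^ card {j. j < i \<and> P j}) (s m)"])
  fix s1 :: "nat \<Rightarrow> nat"
  let ?i = "s1 (Suc m)"
  assume invar: "(\<forall>y < m. s1 y = s y) \<and> s1 m = (g ^^ card {j. j < ?i \<and> P j}) (s m)"
    and in_range: "?i \<le> length w"
  have card_le: "card {j. j < ?i \<and> P j} \<le> length w"
    using card_Collect_less_le in_range by (rule order_trans)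
  show "wp w (Seq c (Cond (AtZero (m + 2)) Skip d)) (\<lambda>s2. s2 (Suc m) = ?i \<and>
      (\<forall>y < m. (s2(Suc m := Suc ?i)) y = s y) \<and>
      (s2(Suc m := Suc ?i)) m = (g ^^ card {j. j < Suc ?i \<and> P j}) (s m)) s1"
  proof (intro wp_Seq wp_mono[OF test])
    fix s2
    assume "returns (m + 2) (P ?i) s1 s2"
    then show "wp w (Cond (AtZero (m + 2)) Skip d) (\<lambda>s2. s2 (Suc m) = ?i \<and>
        (\<forall>y < m. (s2(Suc m := Suc ?i)) y = s y) \<and>
        (s2(Suc m := Suc ?i)) m = (g ^^ card {j. j < Suc ?i \<and> P j}) (s m)) s2"
      using invar card_le
      by (intro wp_Cond wp_Skip update[of "card {j. j < ?i \<and> P j}"])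
        (auto simp: card_Collect_less_Suc returns_def)
  qed (use invar in_range in auto)
qed (auto intro: post simp: less_Suc_eq_le)

subsection \<open>Deciders\<close>

text \<open>The heads above \<open>m\<close> are scratch space.\<close>

definition decider ::
  "('v \<Rightarrow> nat) \<Rightarrow> nat \<Rightarrow> 'a com \<Rightarrow> ('a list \<Rightarrow> ('v \<Rightarrow> nat) \<Rightarrow> bool) \<Rightarrow> bool"
where
  "decider \<rho> m c P \<longleftrightarrow> (\<forall>v. \<rho> v < m) \<and>
     (\<forall>w s. (\<forall>v. s (\<rho> v) \<le> length w) \<longrightarrow> wp w c (returns m (P w (\<lambda>v. s (\<rho> v))) s) s)"

definition decidable :: "('a list \<Rightarrow> ('v \<Rightarrow> nat) \<Rightarrow> bool) \<Rightarrow> bool" where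
  "decidable P \<longleftrightarrow> (\<forall>\<rho> m. (\<forall>v. \<rho> v < m) \<longrightarrow> (\<exists>c. decider \<rho> m c P))"

lemma decidableI:
  fixes P :: "'a list \<Rightarrow> ('v \<Rightarrow> nat) \<Rightarrow> bool"
  assumes "\<And>(\<rho> :: 'v \<Rightarrow> nat) m. (\<And>v. \<rho> v < m) \<Longrightarrow> \<exists>c. decider \<rho> m c P"
  shows "decidable P"
  using assms by (simp add: decidable_def)

lemma decidableE:
  assumes "decidable P" "\<And>v. \<rho> v < m"
  obtains c where "decider \<rho> m c P"
  using assms unfolding decidable_def by blast

lemma deciderI:
  assumes "\<And>v. \<rho> v < m"
    and "\<And>w s. (\<And>v. s (\<rho> v) \<le> length w) \<Longrightarrow> wp w c (returns m (P w (\<lambda>v. s (\<rho> v))) s) s"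
  shows "decider \<rho> m c P"
  using assms by (simp add: decider_def)

lemma wp_decider:
  assumes "decider \<rho> m c P" "\<And>v. s (\<rho> v) \<le> length w"
    and "\<And>s'. returns m (P w (\<lambda>v. s (\<rho> v))) s s' \<Longrightarrow> Q s'"
  shows "wp w c Q s"
proof -
  have "wp w c (returns m (P w (\<lambda>v. s (\<rho> v))) s) s"
    using assms(1,2) by (simp add: decider_def)
  then show ?thesis by (rule wp_mono) (rule assms(3))
qed

theorem decidable_in_PTIME:
  assumes "decidable (\<lambda>(w :: 'a::finite list) (s :: unit \<Rightarrow> nat). P w)"
  shows "{w. P w} \<in> PTIME"
proof -
  obtain c where "decider (\<lambda>_ :: unit. 0) 1 c (\<lambda>(w :: 'a list) s. P w)"
    using decidableE[OF assms, of "\<lambda>_. 0" 1] by auto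
  then have "wp w c (\<lambda>s. s 1 \<noteq> 0 \<longleftrightarrow> w \<in> {w. P w}) (\<lambda>_. 0)" for w
    by (rule wp_decider) (auto simp: returns_def)
  then show ?thesis by (rule program_in_PTIME)
qed

lemma decidable_cong:
  assumes "decidable P" "\<And>w s. (\<And>v. s v \<le> length w) \<Longrightarrow> P w s = Q w s"
  shows "decidable Q"
proof -
  have "decider \<rho> m c Q" if "decider \<rho> m c P" for \<rho> m c
    using that assms(2) by (simp add: decider_def)
  then show ?thesis using assms(1) unfolding decidable_def by blast
qed

lemma decidable_rename:
  fixes f :: "'u \<Rightarrow> 'v"
  assumes "decidable P"
  shows "decidable (\<lambda>w s. P w (\<lambda>v. s (f v)))"
proof (rule decidableI)
  fix \<rho> :: "'v \<Rightarrow> nat" and m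
  assume below_m: "\<And>v. \<rho> v < m"
  then obtain c where "decider (\<lambda>v. \<rho> (f v)) m c P" by (rule decidableE[OF assms])
  then have "decider \<rho> m c (\<lambda>w s. P w (\<lambda>v. s (f v)))" using below_m by (auto simp: decider_def)
  then show "\<exists>c. decider \<rho> m c (\<lambda>w s. P w (\<lambda>v. s (f v)))" ..
qed

lemma decidable_letter: "decidable (\<lambda>(w :: 'a list) (s :: 'v \<Rightarrow> nat). s v < length w \<and> w ! s v = a)"
proof (rule decidableI)
  fix \<rho> :: "'v \<Rightarrow> nat" and m
  assume below_m: "\<And>v. \<rho> v < m"
  then have "\<rho> v \<noteq> m" by (simp add: less_imp_neq)
  then have "decider \<rho> m (Seq (zero m) (Cond (Letter a (\<rho> v)) (Inc m) Skip))
      (\<lambda>w s. s v < length w \<and> w ! s v = a)"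
    by (intro deciderI below_m wp_Seq wp_zero wp_Cond wp_Inc wp_Skip) (auto simp: returns_def)
  then show "\<exists>c. decider \<rho> m c (\<lambda>w s. s v < length w \<and> w ! s v = a)" ..
qed

lemma decidable_less_var: "decidable (\<lambda>(w :: 'a list) (s :: 'v \<Rightarrow> nat). s x < s y)"
proof (rule decidableI)
  fix \<rho> :: "'v \<Rightarrow> nat" and m
  assume below_m: "\<And>v. \<rho> v < m"
  have "decider \<rho> m (if \<rho> x = \<rho> y then zero m else less_prog (\<rho> x) (\<rho> y) m) (\<lambda>w s. s x < s y)"
  proof (rule deciderI[OF below_m])
    fix w and s :: "nat \<Rightarrow> nat"
    assume "\<And>v. s (\<rho> v) \<le> length w"
    then show "wp w (if \<rho> x = \<rho> y then zero m else less_prog (\<rho> x) (\<rho> y) m)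
        (returns m (s (\<rho> x) < s (\<rho> y)) s) s"
      using below_m by (simp add: wp_less_prog wp_zero returns_def)
  qed
  then show "\<exists>c. decider \<rho> m c (\<lambda>w s. s x < s y)" by blast
qed

lemma decidable_not:
  fixes P :: "'a list \<Rightarrow> ('v \<Rightarrow> nat) \<Rightarrow> bool"
  assumes "decidable P"
  shows "decidable (\<lambda>w s. \<not> P w s)"
proof (rule decidableI)
  fix \<rho> :: "'v \<Rightarrow> nat" and m
  assume below_m: "\<And>v. \<rho> v < m"
  then obtain c where "decider \<rho> m c P" by (rule decidableE[OF assms])
  then have "decider \<rho> m (Seq c (negate m)) (\<lambda>w s. \<not> P w s)"
    using below_m
    by (intro deciderI wp_Seq) (auto intro!: wp_decider wp_negate simp: returns_def)
  then show "\<exists>c. decider \<rho> m c (\<lambda>w s. \<not> P w s)" ..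
qed

lemma decidable_conj:
  fixes P Q :: "'a list \<Rightarrow> ('v \<Rightarrow> nat) \<Rightarrow> bool"
  assumes "decidable P" "decidable Q"
  shows "decidable (\<lambda>w s. P w s \<and> Q w s)"
proof (rule decidableI)
  fix \<rho> :: "'v \<Rightarrow> nat" and m
  assume below_m: "\<And>v. \<rho> v < m"
  obtain c where decider_P: "decider \<rho> m c P" using assms(1) below_m by (rule decidableE)
  obtain d where decider_Q: "decider \<rho> m d Q" using assms(2) below_m by (rule decidableE)
  have "decider \<rho> m (Seq c (Cond (AtZero m) Skip d)) (\<lambda>w s. P w s \<and> Q w s)"
  proof (intro deciderI below_m wp_Seq wp_decider[OF decider_P] wp_Cond wp_Skip)
    fix w and s s' :: "nat \<Rightarrow> nat"
    assume in_range: "\<And>v. s (\<rho> v) \<le> length w" and returned: "returns m (P w (\<lambda>v. s (\<rho> v))) s s'"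
      and "\<not> holds w (AtZero m) s'"
    have "s' (\<rho> v) = s (\<rho> v)" for v using returned below_m by (simp add: returns_def)
    then show "wp w d (returns m (P w (\<lambda>v. s (\<rho> v)) \<and> Q w (\<lambda>v. s (\<rho> v))) s) s'"
      using in_range returned \<open>\<not> _\<close> by (intro wp_decider[OF decider_Q]) (auto simp: returns_def)
  qed (auto simp: returns_def)
  then show "\<exists>c. decider \<rho> m c (\<lambda>w s. P w s \<and> Q w s)" ..
qed

text \<open>
  Under a quantifier, the bound variable is the index \<^term>\<open>None\<close> and the free ones are shifted by
  \<^term>\<open>Some\<close>.
\<close>

abbreviation bind_var ::
  "('a list \<Rightarrow> ('v \<Rightarrow> nat) \<Rightarrow> nat \<Rightarrow> bool) \<Rightarrow> 'a list \<Rightarrow> ('v option \<Rightarrow> nat) \<Rightarrow> bool"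
where
  "bind_var P \<equiv> \<lambda>w s. P w (\<lambda>v. s (Some v)) (s None)"

lemma wp_decider_bind_var:
  fixes P :: "'a list \<Rightarrow> ('v \<Rightarrow> nat) \<Rightarrow> nat \<Rightarrow> bool"
  assumes "decider (case_option (Suc m) \<rho>) (m + 2) c (bind_var P)"
    and "\<And>v. \<rho> v < m" and "\<And>v. s (\<rho> v) \<le> length w"
    and "\<forall>x < m. s' x = s x" "s' (Suc m) \<le> length w"
  shows "wp w c (returns (m + 2) (P w (\<lambda>v. s (\<rho> v)) (s' (Suc m))) s') s'"
proof -
  have unchanged: "s' (\<rho> v) = s (\<rho> v)" for v using assms(2,4) by simp
  then have "s' (case_option (Suc m) \<rho> v) \<le> length w" for v using assms(3,5) by (cases v) auto
  then show ?thesis by (intro wp_decider[OF assms(1)]) (auto simp: unchanged)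
qed

lemma decider_card_le:
  fixes P Q :: "'a list \<Rightarrow> ('v \<Rightarrow> nat) \<Rightarrow> nat \<Rightarrow> bool"
  assumes decider_P: "decider (case_option (Suc m) \<rho>) (m + 2) c (bind_var P)"
    and decider_Q: "decider (case_option (Suc m) \<rho>) (m + 2) d (bind_var Q)"
    and below_m: "\<And>v. \<rho> v < m"
  shows "decider \<rho> m
    (Seq (Seq (zero m) (for_prog (Suc m) (Seq c (Cond (AtZero (m + 2)) Skip (Inc m)))))
         (Seq (for_prog (Suc m) (Seq d (Cond (AtZero (m + 2)) Skip (Dec m)))) (negate m)))
    (\<lambda>w s. card {i. i \<le> length w \<and> P w s i} \<le> card {i. i \<le> length w \<and> Q w s i})"
    (is "decider \<rho> m (Seq ?up ?down) (\<lambda>w s. ?p w s \<le> ?q w s)")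
proof (rule deciderI[OF below_m], rule wp_Seq)
  fix w :: "'a list" and s :: "nat \<Rightarrow> nat"
  assume in_range: "\<And>v. s (\<rho> v) \<le> length w"
  let ?le = "?p w (\<lambda>v. s (\<rho> v)) \<le> ?q w (\<lambda>v. s (\<rho> v))"
  have pred_funpow: "((\<lambda>v. v - Suc 0) ^^ j) v = v - j" for j v :: nat
    by (induction j) auto
  have down: "wp w ?down (returns m ?le s) s1"
    if "\<forall>x < m. s1 x = s x" "s1 m = ?p w (\<lambda>v. s (\<rho> v))" for s1
    using that
    by (intro wp_Seq wp_Dec wp_negate
        wp_for_prog_count[where g = "\<lambda>v. v - 1" and P = "Q w (\<lambda>v. s (\<rho> v))"]
        wp_decider_bind_var[where P = Q and s = s, OF decider_Q below_m in_range])
      (auto simp: pred_funpow returns_def)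
  show "wp w ?up (wp w ?down (returns m ?le s)) s"
    by (intro wp_Seq[of _ "zero m"] wp_zero wp_Inc down
        wp_for_prog_count[where g = Suc and P = "P w (\<lambda>v. s (\<rho> v))"]
        wp_decider_bind_var[where P = P and s = s, OF decider_P below_m in_range]) auto
qed

lemma decidable_card_le:
  fixes P Q :: "'a list \<Rightarrow> ('v \<Rightarrow> nat) \<Rightarrow> nat \<Rightarrow> bool"
  assumes "decidable (bind_var P)" "decidable (bind_var Q)"
  shows "decidable (\<lambda>w s. card {i. i \<le> length w \<and> P w s i} \<le> card {i. i \<le> length w \<and> Q w s i})"
proof (rule decidableI)
  fix \<rho> :: "'v \<Rightarrow> nat" and m
  assume below_m: "\<And>v. \<rho> v < m"
  then have below: "case_option (Suc m) \<rho> v < m + 2" for v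
    by (auto split: option.split intro: less_SucI)
  obtain c where decider_P: "decider (case_option (Suc m) \<rho>) (m + 2) c (bind_var P)"
    using assms(1) below by (rule decidableE)
  obtain d where "decider (case_option (Suc m) \<rho>) (m + 2) d (bind_var Q)"
    using assms(2) below by (rule decidableE)
  from decider_card_le[where P = P and Q = Q, OF decider_P this below_m]
  show "\<exists>c. decider \<rho> m c (\<lambda>w s. card {i. i \<le> length w \<and> P w s i} \<le>
      card {i. i \<le> length w \<and> Q w s i})" ..
qed

section \<open>Closure properties of decidable predicates\<close>

lemma decidable_disj: "decidable P \<Longrightarrow> decidable Q \<Longrightarrow> decidable (\<lambda>w s. P w s \<or> Q w s)"
  using decidable_not[OF decidable_conj[OF decidable_not decidable_not], of P Q] by simp

lemma decidable_imp: "decidable P \<Longrightarrow> decidable Q \<Longrightarrow> decidable (\<lambda>w s. P w s \<longrightarrow> Q w s)"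
  using decidable_disj[OF decidable_not, of P Q] by simp

lemma decidable_const: "decidable (\<lambda>w s. b)"
proof -
  have "decidable (\<lambda>w s. s undefined < s undefined)" by (rule decidable_less_var)
  from this decidable_not[OF this] show ?thesis by (cases b) simp_all
qed

lemma decidable_ball_finite:
  assumes "finite A" "\<And>a. a \<in> A \<Longrightarrow> decidable (P a)"
  shows "decidable (\<lambda>w s. \<forall>a \<in> A. P a w s)"
  using assms by (induction A) (simp_all add: decidable_const decidable_conj)

lemma decidable_bex_finite:
  assumes "finite A" "\<And>a. a \<in> A \<Longrightarrow> decidable (P a)"
  shows "decidable (\<lambda>w s. \<exists>a \<in> A. P a w s)"
  using assms by (induction A) (simp_all add: decidable_const decidable_disj)

lemma decidable_ex:
  assumes "decidable (bind_var P)"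
  shows "decidable (\<lambda>w s. \<exists>i \<le> length w. P w s i)"
proof (rule decidable_cong)
  show "decidable (\<lambda>w s. \<not> card {i. i \<le> length w \<and> P w s i} \<le> card {i. i \<le> length w \<and> False})"
    by (intro decidable_not decidable_card_le assms decidable_const)
qed auto

lemma decidable_all:
  assumes "decidable (bind_var P)"
  shows "decidable (\<lambda>w s. \<forall>i \<le> length w. P w s i)"
proof -
  have "decidable (\<lambda>w s. \<not> (\<exists>i \<le> length w. \<not> P w s i))"
    by (intro decidable_not decidable_ex assms)
  then show ?thesis by simp
qed

lemma decidable_ex_update:
  assumes "decidable P"
  shows "decidable (\<lambda>w s. \<exists>i \<le> length w. P w (s(v := i)))"
proof (rule decidable_ex)
  have "decidable (\<lambda>w s. P w (\<lambda>u. s (if u = v then None else Some u)))"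
    by (rule decidable_rename[OF assms])
  then show "decidable (\<lambda>w s. P w ((\<lambda>u. s (Some u))(v := s None)))"
    by (simp add: fun_upd_def if_distrib)
qed

lemma decidable_ex_override_on:
  fixes P :: "'a list \<Rightarrow> ('v \<Rightarrow> nat) \<Rightarrow> bool"
  assumes "finite A" "decidable P"
  shows "decidable (\<lambda>w s. \<exists>g. (\<forall>a \<in> A. g a \<le> length w) \<and> P w (override_on s g A))"
  using assms(1)
proof (induction A)
  case empty
  then show ?case using assms(2) by simp
next
  case (insert a A)
  let ?Q = "\<lambda>(w :: 'a list) (s :: 'v \<Rightarrow> nat). \<exists>g. (\<forall>a \<in> A. g a \<le> length w) \<and> P w (override_on s g A)"
  have "decidable (\<lambda>w s. \<exists>i \<le> length w. ?Q w (s(a := i)))"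
    by (rule decidable_ex_update[OF insert.IH])
  then show ?case
  proof (rule decidable_cong)
    fix w :: "'a list" and s :: "'v \<Rightarrow> nat"
    have override_on_upd:
      "override_on (s(a := i)) g A = override_on s (g(a := i)) (insert a A)" for g i
      using insert.hyps(2) by (auto simp: override_on_def)
    show "(\<exists>i \<le> length w. ?Q w (s(a := i))) \<longleftrightarrow>
        (\<exists>g. (\<forall>b \<in> insert a A. g b \<le> length w) \<and> P w (override_on s g (insert a A)))"
    proof
      assume "\<exists>i \<le> length w. ?Q w (s(a := i))"
      then obtain i g where "i \<le> length w" "\<forall>b \<in> A. g b \<le> length w"
          "P w (override_on s (g(a := i)) (insert a A))" by (auto simp: override_on_upd)
      then show "\<exists>g. (\<forall>b \<in> insert a A. g b \<le> length w) \<and> P w (override_on s g (insert a A))"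
        using insert.hyps(2) by (intro exI[of _ "g(a := i)"]) auto
    next
      assume "\<exists>g. (\<forall>b \<in> insert a A. g b \<le> length w) \<and> P w (override_on s g (insert a A))"
      then obtain g where "\<forall>b \<in> insert a A. g b \<le> length w" "P w (override_on s g (insert a A))"
        by blast
      then show "\<exists>i \<le> length w. ?Q w (s(a := i))"
        by (intro exI[of _ "g a"] conjI exI[of _ g]) (auto simp: override_on_upd)
    qed
  qed
qed

subsection \<open>Computable terms\<close>

text \<open>
  Only the values of a term up to \<open>length w\<close> are visible to its graph, so a term may exceed the
  range of the variables.
\<close>

definition computable :: "('a list \<Rightarrow> ('v \<Rightarrow> nat) \<Rightarrow> nat) \<Rightarrow> bool" where
  "computable t \<longleftrightarrow> decidable (\<lambda>w s. t w (\<lambda>v. s (Some v)) = s None)"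

definition visible :: "('a list \<Rightarrow> ('v \<Rightarrow> nat) \<Rightarrow> nat) \<Rightarrow> bool" where
  "visible t \<longleftrightarrow> (\<forall>w s. (\<forall>v. s v \<le> length w) \<longrightarrow> t w s \<le> length w)"

lemma visibleD: "visible t \<Longrightarrow> (\<And>v. s v \<le> length w) \<Longrightarrow> t w s \<le> length w"
  by (simp add: visible_def)

lemma visible_var: "visible (\<lambda>w s. s x)"
  by (simp add: visible_def)

lemma visible_0: "visible (\<lambda>w s. 0)"
  by (simp add: visible_def)

lemma visible_length: "visible (\<lambda>w s. length w)"
  by (simp add: visible_def)

lemma visible_shift: "visible t \<Longrightarrow> visible (\<lambda>w s. t w (\<lambda>v. s (Some v)))"
  by (simp add: visible_def)

lemma visible_card_less: "visible t \<Longrightarrow> visible (\<lambda>w s. card {i. i < t w s \<and> P w s i})"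
  unfolding visible_def by (blast intro: order_trans[OF card_Collect_less_le])

lemma computable_rename:
  assumes "computable t"
  shows "computable (\<lambda>w s. t w (\<lambda>v. s (f v)))"
  using decidable_rename[OF assms[unfolded computable_def], of "map_option f"]
  by (simp add: computable_def)

lemma computable_shift: "computable t \<Longrightarrow> computable (\<lambda>w s. t w (\<lambda>v. s (Some v)))"
  by (rule computable_rename)

lemma decidable_eq_var: "decidable (\<lambda>w s. s x = s y)"
proof -
  have "decidable (\<lambda>w s. \<not> s x < s y \<and> \<not> s y < s x)"
    by (intro decidable_conj decidable_not decidable_less_var)
  then show ?thesis by (rule decidable_cong) auto
qed

lemma computable_var: "computable (\<lambda>w s. s x)"
  unfolding computable_def by (rule decidable_eq_var)

lemma decidable_subst:
  assumes "computable t" "decidable (bind_var P)"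
  shows "decidable (\<lambda>w s. t w s \<le> length w \<and> P w s (t w s))"
proof (rule decidable_cong)
  show "decidable (\<lambda>w s. \<exists>i \<le> length w. t w s = i \<and> P w s i)"
    using assms by (intro decidable_ex decidable_conj) (simp_all add: computable_def)
qed auto

lemma decidable_eq:
  assumes "computable t" "computable u" "visible t"
  shows "decidable (\<lambda>w s. t w s = u w s)"
proof (rule decidable_cong)
  show "decidable (\<lambda>w s. t w s \<le> length w \<and> u w s = t w s)"
    using assms(1) by (rule decidable_subst) (use assms(2) in \<open>simp add: computable_def\<close>)
qed (use visibleD[OF assms(3)] in auto)

lemma decidable_less_if_right_visible:
  fixes t u :: "'a list \<Rightarrow> ('v \<Rightarrow> nat) \<Rightarrow> nat"
  assumes "computable t" "computable u" "visible u"
  shows "decidable (\<lambda>w s. t w s < u w s)"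
proof (rule decidable_cong)
  show "decidable (\<lambda>w s. \<exists>i \<le> length w. u w s = i \<and> (\<exists>j \<le> length w. t w s = j \<and> j < i))"
    using assms(2) computable_shift[OF assms(1)] unfolding computable_def
    by (intro decidable_ex decidable_conj decidable_less_var)
next
  fix w :: "'a list" and s :: "'v \<Rightarrow> nat"
  assume "\<And>v. s v \<le> length w"
  then have "u w s \<le> length w" by (rule visibleD[OF assms(3)])
  then show "(\<exists>i \<le> length w. u w s = i \<and> (\<exists>j \<le> length w. t w s = j \<and> j < i)) \<longleftrightarrow> t w s < u w s"
    by auto
qed

lemma decidable_less:
  assumes "computable t" "computable u" "visible t"
  shows "decidable (\<lambda>w s. t w s < u w s)"
proof (rule decidable_cong)
  show "decidable (\<lambda>w s. \<not> (u w s < t w s \<or> t w s = u w s))"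
    by (intro decidable_not decidable_disj decidable_less_if_right_visible decidable_eq assms)
qed auto

lemma decidable_le:
  assumes "computable t" "computable u" "visible t"
  shows "decidable (\<lambda>w s. t w s \<le> u w s)"
proof (rule decidable_cong)
  show "decidable (\<lambda>w s. \<not> u w s < t w s)"
    by (intro decidable_not decidable_less_if_right_visible assms)
qed auto

lemma computable_card:
  fixes P :: "'a list \<Rightarrow> ('v \<Rightarrow> nat) \<Rightarrow> nat \<Rightarrow> bool"
  assumes "decidable (bind_var P)"
  shows "computable (\<lambda>w s. card {i. i \<le> length w \<and> P w s i})"
proof -
  let ?p = "\<lambda>w (s :: 'v option \<Rightarrow> nat). card {i. i \<le> length w \<and> P w (\<lambda>v. s (Some v)) i}"
  let ?less = "\<lambda>w (s :: 'v option \<Rightarrow> nat). card {i. i \<le> length w \<and> i < s None}"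
  have "decidable (\<lambda>w s. P w (\<lambda>v. s (Some (Some v))) (s None))"
    using decidable_rename[OF assms, of "map_option Some"] by simp
  then have "decidable (\<lambda>w s. ?p w s \<le> ?less w s \<and> ?less w s \<le> ?p w s)"
    by (intro decidable_conj decidable_card_le decidable_less_var)
  then show ?thesis unfolding computable_def
  proof (rule decidable_cong)
    fix w :: "'a list" and s :: "'v option \<Rightarrow> nat"
    assume "\<And>v. s v \<le> length w"
    from this[of None] have "{i. i \<le> length w \<and> i < s None} = {..<s None}" by auto
    then have "?less w s = s None" by simp
    then show "?p w s \<le> ?less w s \<and> ?less w s \<le> ?p w s \<longleftrightarrow> ?p w s = s None" by linarith
  qed
qed

lemma computable_0: "computable (\<lambda>w s. 0)"
  using computable_card[of "\<lambda>w s i. False"] by (simp add: decidable_const)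

lemma computable_length: "computable (\<lambda>w s. length w)"
proof -
  have "decidable (\<lambda>w s. \<forall>i \<le> length w. \<not> s None < i)"
    by (intro decidable_all decidable_not decidable_less_var)
  then show ?thesis unfolding computable_def
    by (rule decidable_cong) (metis le_antisym not_le order_refl)
qed

lemma computable_card_less:
  fixes t :: "'a list \<Rightarrow> ('v \<Rightarrow> nat) \<Rightarrow> nat"
  assumes "computable t" "visible t" "decidable (bind_var P)"
  shows "computable (\<lambda>w s. card {i. i < t w s \<and> P w s i})"
proof -
  have "computable (\<lambda>w s. card {i. i \<le> length w \<and> i < t w s \<and> P w s i})"
    using assms(3)
    by (intro computable_card decidable_conj decidable_less computable_var computable_shift
        visible_var assms(1))
  then show ?thesis unfolding computable_def
  proof (rule decidable_cong)
    fix w :: "'a list" and s :: "'v option \<Rightarrow> nat"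
    let ?s = "\<lambda>v. s (Some v)"
    assume "\<And>v. s v \<le> length w"
    then have "i \<le> length w" if "i < t w ?s" for i
      using that visibleD[OF assms(2), of ?s w] by simp
    then have "{i. i \<le> length w \<and> i < t w ?s \<and> P w ?s i} = {i. i < t w ?s \<and> P w ?s i}" by blast
    then show "card {i. i \<le> length w \<and> i < t w ?s \<and> P w ?s i} = s None \<longleftrightarrow>
        card {i. i < t w ?s \<and> P w ?s i} = s None" by simp
  qed
qed

lemma decidable_add_var: "decidable (\<lambda>(w :: 'a list) (s :: 'v \<Rightarrow> nat). s x + s y = s z)"
proof (rule decidable_cong)
  show "decidable (\<lambda>(w :: 'a list) s. \<not> s z < s x \<and> s y = card {i. i < s z \<and> \<not> i < s x})"
    by (intro decidable_conj decidable_not decidable_less_var decidable_eq computable_var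
        computable_card_less visible_var)
next
  fix s :: "'v \<Rightarrow> nat"
  have "{i. i < s z \<and> \<not> i < s x} = {s x..<s z}" by auto
  then have "card {i. i < s z \<and> \<not> i < s x} = s z - s x" by simp
  then show "\<not> s z < s x \<and> s y = card {i. i < s z \<and> \<not> i < s x} \<longleftrightarrow> s x + s y = s z" by linarith
qed

lemma computable_add:
  fixes t u :: "'a list \<Rightarrow> ('v \<Rightarrow> nat) \<Rightarrow> nat"
  assumes "computable t" "computable u"
  shows "computable (\<lambda>w s. t w s + u w s)"
proof -
  have "decidable (\<lambda>w s. t w (\<lambda>v. s (Some (Some (Some v)))) = s (Some None))"
    using decidable_rename[OF assms(1)[unfolded computable_def],
        of "case_option (Some None) (\<lambda>v. Some (Some (Some v)))"] by simp
  moreover have "decidable (\<lambda>w s. u w (\<lambda>v. s (Some (Some (Some v)))) = s None)"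
    using decidable_rename[OF assms(2)[unfolded computable_def],
        of "case_option None (\<lambda>v. Some (Some (Some v)))"] by simp
  ultimately have "decidable (\<lambda>w s. \<exists>a \<le> length w. \<exists>b \<le> length w.
      t w (\<lambda>v. s (Some v)) = a \<and> u w (\<lambda>v. s (Some v)) = b \<and> a + b = s None)"
    by (intro decidable_ex decidable_conj decidable_add_var)
  then show ?thesis unfolding computable_def
  proof (rule decidable_cong)
    fix w :: "'a list" and s :: "'v option \<Rightarrow> nat"
    assume "\<And>v. s v \<le> length w"
    from this[of None]
    show "(\<exists>a \<le> length w. \<exists>b \<le> length w.
        t w (\<lambda>v. s (Some v)) = a \<and> u w (\<lambda>v. s (Some v)) = b \<and> a + b = s None) \<longleftrightarrow>
      t w (\<lambda>v. s (Some v)) + u w (\<lambda>v. s (Some v)) = s None" by auto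
  qed
qed

lemma computable_Suc_0: "computable (\<lambda>(w :: 'a list) (s :: 'v \<Rightarrow> nat). Suc 0)"
proof -
  have "decidable (\<lambda>(w :: 'a list) (s :: 'v option \<Rightarrow> nat).
      \<not> s None = 0 \<and> (\<forall>i \<le> length w. i < s None \<longrightarrow> i = 0))"
    by (intro decidable_conj decidable_not decidable_all decidable_imp decidable_less_var
        decidable_eq computable_var computable_0 visible_var)
  then show ?thesis unfolding computable_def
  proof (rule decidable_cong)
    fix w :: "'a list" and s :: "'v option \<Rightarrow> nat"
    assume "\<And>v. s v \<le> length w"
    from this[of None]
    show "(\<not> s None = 0 \<and> (\<forall>i \<le> length w. i < s None \<longrightarrow> i = 0)) \<longleftrightarrow> Suc 0 = s None"
      by (cases "s None \<le> 1") (auto intro!: exI[of _ "1 :: nat"])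
  qed
qed

lemma computable_Suc: "computable t \<Longrightarrow> computable (\<lambda>w s. Suc (t w s))"
  using computable_add[OF _ computable_Suc_0, of t] by simp

lemma computable_const: "computable (\<lambda>w s. k)"
  by (induction k) (simp_all add: computable_0 computable_Suc)

lemma computable_sum:
  assumes "finite A" "\<And>a. a \<in> A \<Longrightarrow> computable (t a)"
  shows "computable (\<lambda>w s. \<Sum>a \<in> A. t a w s)"
  using assms by (induction A) (simp_all add: computable_0 computable_add)

lemma decidable_all_le:
  fixes t :: "'a list \<Rightarrow> ('v \<Rightarrow> nat) \<Rightarrow> nat"
  assumes "computable t" "visible t" "decidable (bind_var P)"
  shows "decidable (\<lambda>w s. \<forall>i \<le> t w s. P w s i)"
proof (rule decidable_cong)
  show "decidable (\<lambda>w s. \<forall>i \<le> length w. i \<le> t w s \<longrightarrow> P w s i)"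
    using assms(3)
    by (intro decidable_all decidable_imp decidable_le computable_var computable_shift
        visible_var assms(1))
next
  fix w :: "'a list" and s :: "'v \<Rightarrow> nat"
  assume "\<And>v. s v \<le> length w"
  then have "t w s \<le> length w" by (rule visibleD[OF assms(2)])
  then show "(\<forall>i \<le> length w. i \<le> t w s \<longrightarrow> P w s i) \<longleftrightarrow> (\<forall>i \<le> t w s. P w s i)" by auto
qed

lemma decidable_all_less:
  assumes "computable t" "visible t" "decidable (bind_var P)"
  shows "decidable (\<lambda>w s. \<forall>i < t w s. P w s i)"
proof (rule decidable_cong)
  show "decidable (\<lambda>w s. \<forall>i \<le> t w s. i < t w s \<longrightarrow> P w s i)"
    using assms(3)
    by (intro decidable_all_le decidable_imp decidable_less computable_var computable_shift
        visible_var assms(1,2))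
qed auto

text \<open>The variable \<^term>\<open>Inr a\<close> is guessed to hold the value of the term \<^term>\<open>t a\<close>.\<close>

lemma decidable_subst_family_default:
  fixes P :: "'a list \<Rightarrow> ('u \<Rightarrow> nat) \<Rightarrow> bool" and t :: "'u \<Rightarrow> 'a list \<Rightarrow> ('v \<Rightarrow> nat) \<Rightarrow> nat"
  assumes "finite A" "decidable P"
    and "\<And>a. a \<in> A \<Longrightarrow> computable (t a)" and "\<And>a. a \<in> A \<Longrightarrow> visible (t a)"
  shows "decidable (\<lambda>w s. P w (\<lambda>a. if a \<in> A then t a w s else s z))"
proof -
  define Q where "Q w r \<longleftrightarrow> (\<forall>a \<in> A. r (Inr a) = t a w (\<lambda>v. r (Inl v))) \<and> P w (\<lambda>a. r (Inr a))"
    for w and r :: "'v + 'u \<Rightarrow> nat"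
  let ?start = "\<lambda>s x. s (case_sum id (\<lambda>_. z) x)"
  let ?R = "\<lambda>w r. \<exists>g. (\<forall>x \<in> Inr ` A. g x \<le> length w) \<and> Q w (override_on r g (Inr ` A))"
  have "decidable Q"
    unfolding Q_def
    by (intro decidable_conj decidable_ball_finite decidable_eq computable_var visible_var
        decidable_rename[OF assms(2)] computable_rename[OF assms(3)] assms(1)) auto
  then have "decidable ?R" using assms(1) by (intro decidable_ex_override_on) auto
  then have "decidable (\<lambda>w s. ?R w (?start s))" by (rule decidable_rename)
  then show ?thesis
  proof (rule decidable_cong)
    fix w :: "'a list" and s :: "'v \<Rightarrow> nat"
    assume in_range: "\<And>v. s v \<le> length w"
    have "(\<lambda>a. override_on (?start s) g (Inr ` A) (Inr a)) = (\<lambda>a. if a \<in> A then g (Inr a) else s z)"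
        "(\<lambda>v. override_on (?start s) g (Inr ` A) (Inl v)) = s" for g
      by (auto simp: override_on_def)
    then have Q_start: "Q w (override_on (?start s) g (Inr ` A)) \<longleftrightarrow>
        (\<forall>a \<in> A. g (Inr a) = t a w s) \<and> P w (\<lambda>a. if a \<in> A then t a w s else s z)" for g
      by (simp add: Q_def cong: conj_cong if_cong)
    have "\<exists>g. (\<forall>x \<in> Inr ` A. g x \<le> length w) \<and> (\<forall>a \<in> A. g (Inr a :: 'v + 'u) = t a w s)"
      by (intro exI[of _ "case_sum s (\<lambda>a. t a w s)"]) (use visibleD[OF assms(4) in_range] in auto)
    then show "?R w (?start s) \<longleftrightarrow> P w (\<lambda>a. if a \<in> A then t a w s else s z)"
      unfolding Q_start by blast
  qed
qed

lemma decidable_subst_family: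
  assumes "finite A" "decidable P"
    and "\<And>a. a \<in> A \<Longrightarrow> computable (t a)" and "\<And>a. a \<in> A \<Longrightarrow> visible (t a)"
  shows "decidable (\<lambda>w s. P w (\<lambda>a. if a \<in> A then t a w s else 0))"
proof -
  have "decidable (\<lambda>w s. P w (\<lambda>a. if a \<in> A then t a w (\<lambda>v. s (Some v)) else s None))"
    using assms by (intro decidable_subst_family_default computable_shift visible_shift)
  then have "decidable (\<lambda>w s. 0 \<le> length w \<and> P w (\<lambda>a. if a \<in> A then t a w s else 0))"
    by (rule decidable_subst[OF computable_0])
  then show ?thesis by simp
qed

section \<open>Column histograms\<close>

definition columns :: "nat \<Rightarrow> pinst set" where
  "columns m = {\<tau>. length \<tau> = m}"

definition column :: "pinst list \<Rightarrow> nat \<Rightarrow> pinst" where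
  "column es i = map (\<lambda>e. e ! i) es"

definition hist :: "nat \<Rightarrow> pinst list \<Rightarrow> pinst \<Rightarrow> nat" where
  "hist n es \<tau> = card {i. i < n \<and> column es i = \<tau>}"

definition histogram :: "nat \<Rightarrow> pinst list \<Rightarrow> (pinst \<Rightarrow> nat) \<Rightarrow> bool" where
  "histogram n es h \<longleftrightarrow> (\<forall>\<tau> \<in> columns (length es). h \<tau> = hist n es \<tau>)"

definition lookup :: "nat list \<Rightarrow> 'b list \<Rightarrow> nat \<Rightarrow> 'b" where
  "lookup xs ys x = the (map_of (zip xs ys) x)"

definition undef_count :: "nat list \<Rightarrow> (pinst \<Rightarrow> nat) \<Rightarrow> nat \<Rightarrow> nat" where
  "undef_count xs h x = (\<Sum>\<tau> | \<tau> \<in> columns (length xs) \<and> lookup xs \<tau> x = None. h \<tau>)"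

text \<open>
  Values of a histogram for columns of different lengths do not interfere, so that one function
  carries the histograms of all quantifier depths.
\<close>

definition refines :: "nat \<Rightarrow> (pinst \<Rightarrow> nat) \<Rightarrow> (pinst \<Rightarrow> nat) \<Rightarrow> bool" where
  "refines m h h' \<longleftrightarrow> (\<forall>\<tau>. \<tau> \<notin> columns (Suc m) \<longrightarrow> h' \<tau> = h \<tau>) \<and>
     (\<forall>\<tau> \<in> columns m. h' \<tau> = (\<Sum>v \<in> UNIV. h' (v # \<tau>)))"

text \<open>
  For instances of dimension at most \<open>N\<close> the bound by \<open>N\<close> in the clause for \<^const>\<open>Prec\<close> always
  holds; it makes the clause decidable for arbitrary \<open>h\<close>.
\<close>

fun hist_sat :: "nat \<Rightarrow> nat list \<Rightarrow> (pinst \<Rightarrow> nat) \<Rightarrow> fo \<Rightarrow> bool" where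
  "hist_sat N xs h (Subs x y) \<longleftrightarrow> (\<forall>\<tau> \<in> columns (length xs).
     lookup xs \<tau> x \<noteq> None \<and> lookup xs \<tau> x \<noteq> lookup xs \<tau> y \<longrightarrow> h \<tau> = 0)"
| "hist_sat N xs h (Prec x y) \<longleftrightarrow>
     undef_count xs h y \<le> N \<and> undef_count xs h y \<le> undef_count xs h x"
| "hist_sat N xs h (Equal x y) \<longleftrightarrow>
     (\<forall>\<tau> \<in> columns (length xs). lookup xs \<tau> x \<noteq> lookup xs \<tau> y \<longrightarrow> h \<tau> = 0)"
| "hist_sat N xs h (Neg \<phi>) \<longleftrightarrow> \<not> hist_sat N xs h \<phi>"
| "hist_sat N xs h (Conj \<phi> \<psi>) \<longleftrightarrow> hist_sat N xs h \<phi> \<and> hist_sat N xs h \<psi>"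
| "hist_sat N xs h (Disj \<phi> \<psi>) \<longleftrightarrow> hist_sat N xs h \<phi> \<or> hist_sat N xs h \<psi>"
| "hist_sat N xs h (Exists x \<phi>) \<longleftrightarrow> (\<exists>h'. refines (length xs) h h' \<and> hist_sat N (x # xs) h' \<phi>)"
| "hist_sat N xs h (Forall x \<phi>) \<longleftrightarrow> (\<forall>h'. refines (length xs) h h' \<longrightarrow> hist_sat N (x # xs) h' \<phi>)"

lemma finite_columns [simp]: "finite (columns m)"
  using finite_lists_length_eq[of "UNIV :: bool option set" m] by (simp add: columns_def)

lemma column_in_columns [simp]: "column es i \<in> columns (length es)"
  by (simp add: column_def columns_def)

lemma lookup_column:
  assumes "x \<in> set xs" "length es = length xs"
  shows "lookup xs (column es i) x = lookup xs es x ! i"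
proof -
  have "map_of (zip xs (column es i)) = map_option (\<lambda>e. e ! i) \<circ> map_of (zip xs es)"
    unfolding column_def zip_map2 by (rule map_of_map)
  moreover obtain e where "map_of (zip xs es) x = Some e"
    using assms by (metis map_of_zip_is_Some)
  ultimately show ?thesis by (simp add: lookup_def)
qed

lemma lookup_in_set:
  assumes "x \<in> set xs" "length es = length xs"
  shows "lookup xs es x \<in> set es"
proof -
  obtain e where "map_of (zip xs es) x = Some e"
    using assms by (metis map_of_zip_is_Some)
  then show ?thesis by (auto simp: lookup_def dest: map_of_SomeD set_zip_rightD)
qed

lemma lookup_Cons: "lookup (x # xs) (e # es) = (lookup xs es)(x := e)"
  by (auto simp: lookup_def fun_eq_iff)

lemma hist_eq_0_iff: "hist n es \<tau> = 0 \<longleftrightarrow> (\<forall>i < n. column es i \<noteq> \<tau>)"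
  by (auto simp: hist_def)

lemma ball_columns_hist_iff:
  "(\<forall>\<tau> \<in> columns (length es). P \<tau> \<longrightarrow> hist n es \<tau> = 0) \<longleftrightarrow> (\<forall>i < n. \<not> P (column es i))"
  by (auto simp: hist_eq_0_iff)

lemma sum_card_fibres:
  assumes "finite A" "finite B"
  shows "(\<Sum>b \<in> B. card {i \<in> A. f i = b}) = card {i \<in> A. f i \<in> B}"
proof -
  have "card {i \<in> A. f i \<in> B} = (\<Sum>b \<in> B. card {i \<in> {i \<in> A. f i \<in> B}. f i = b})"
    unfolding card_eq_sum using assms by (intro sum.group[symmetric]) auto
  also have "\<dots> = (\<Sum>b \<in> B. card {i \<in> A. f i = b})"
    by (intro sum.cong refl arg_cong[of _ _ card]) auto
  finally show ?thesis ..
qed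

lemma ex_fun_card_fibres:
  assumes "finite B" "finite S" "card S = (\<Sum>b \<in> B. c b)"
  shows "\<exists>g. g ` S \<subseteq> B \<and> (\<forall>b \<in> B. card {i \<in> S. g i = b} = c b)"
  using assms
proof (induction B arbitrary: S)
  case (insert b B)
  then have "c b \<le> card S" by simp
  then obtain A where subset: "A \<subseteq> S" "card A = c b" "finite A"
    by (rule obtain_subset_with_card_n)
  then have "card (S - A) = (\<Sum>b \<in> B. c b)"
    using insert by (simp add: card_Diff_subset)
  then obtain g where image: "g ` (S - A) \<subseteq> B"
      "\<And>b. b \<in> B \<Longrightarrow> card {i \<in> S - A. g i = b} = c b"
    using insert.IH[of "S - A"] insert.prems by auto
  let ?g = "\<lambda>i. if i \<in> A then b else g i"
  have "{i \<in> S. ?g i = b} = A" using image(1) subset(1) insert.hyps(2) by auto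
  moreover have "{i \<in> S. ?g i = a} = {i \<in> S - A. g i = a}" if "a \<in> B" for a
    using that insert.hyps(2) by auto
  ultimately show ?case using image subset(2) by (intro exI[of _ ?g]) auto
qed simp

lemma hist_marginal: "hist n es \<tau> = (\<Sum>v \<in> UNIV. hist n (e # es) (v # \<tau>))"
proof -
  have "hist n es \<tau> = card {i \<in> {i. i < n \<and> column es i = \<tau>}. e ! i \<in> UNIV}"
    by (simp add: hist_def)
  also have "\<dots> = (\<Sum>v \<in> UNIV. card {i \<in> {i. i < n \<and> column es i = \<tau>}. e ! i = v})"
    by (rule sum_card_fibres[symmetric]) auto
  also have "\<dots> = (\<Sum>v \<in> UNIV. hist n (e # es) (v # \<tau>))"
    unfolding hist_def column_def by (intro sum.cong refl arg_cong[of _ _ card]) auto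
  finally show ?thesis .
qed

lemma ex_refines_histogram:
  assumes "histogram n es h"
  shows "\<exists>h'. refines (length es) h h' \<and> histogram n (e # es) h'"
proof -
  let ?h = "override_on h (hist n (e # es)) (columns (Suc (length es)))"
  have "?h \<tau> = (\<Sum>v \<in> UNIV. ?h (v # \<tau>))" if "\<tau> \<in> columns (length es)" for \<tau>
    using that assms hist_marginal[of n es \<tau> e]
    by (simp add: histogram_def columns_def override_on_def)
  then have "refines (length es) h ?h" by (simp add: refines_def override_on_def)
  then show ?thesis by (intro exI[of _ ?h]) (simp add: histogram_def override_on_def)
qed

lemma ex_pinst_histogram:
  assumes "refines (length es) h h'" "histogram n es h"
  shows "\<exists>e \<in> pinsts n. histogram n (e # es) h'"
proof -
  let ?S = "\<lambda>\<tau>. {i. i < n \<and> column es i = \<tau>}"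
  have "\<exists>g. \<forall>v. card {i \<in> ?S \<tau>. g i = v} = h' (v # \<tau>)" if "\<tau> \<in> columns (length es)" for \<tau>
  proof -
    have "\<tau> \<notin> columns (Suc (length es))" using that by (simp add: columns_def)
    then have "h' \<tau> = h \<tau>" "h' \<tau> = (\<Sum>v \<in> UNIV. h' (v # \<tau>))"
      using assms(1) that unfolding refines_def by blast+
    then have "card (?S \<tau>) = (\<Sum>v \<in> UNIV. h' (v # \<tau>))"
      using assms(2) that by (metis hist_def histogram_def)
    then show ?thesis using ex_fun_card_fibres[of UNIV "?S \<tau>" "\<lambda>v. h' (v # \<tau>)"] by auto
  qed
  then have "\<forall>\<tau> \<in> columns (length es). \<exists>g. \<forall>v. card {i \<in> ?S \<tau>. g i = v} = h' (v # \<tau>)" ..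
  from bchoice[OF this] obtain g where
    split: "\<And>\<tau> v. \<tau> \<in> columns (length es) \<Longrightarrow> card {i \<in> ?S \<tau>. g \<tau> i = v} = h' (v # \<tau>)" by blast
  define e where "e = map (\<lambda>i. g (column es i) i) [0..<n]"
  have "h' \<tau> = hist n (e # es) \<tau>" if "\<tau> \<in> columns (Suc (length es))" for \<tau>
  proof -
    obtain v \<tau>' where Cons: "\<tau> = v # \<tau>'" "\<tau>' \<in> columns (length es)"
      using \<open>\<tau> \<in> _\<close> by (auto simp: columns_def length_Suc_conv)
    have "{i. i < n \<and> column (e # es) i = \<tau>} = {i \<in> ?S \<tau>'. g \<tau>' i = v}"
      unfolding Cons(1) by (auto simp: column_def e_def)
    then show ?thesis using split[OF Cons(2), of v] Cons(1) by (simp add: hist_def)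
  qed
  then show ?thesis by (intro bexI[of _ e]) (simp_all add: histogram_def e_def pinsts_def)
qed

lemma ex_pinst_iff_ex_refines:
  assumes "histogram n es h"
    and "\<And>e h'. e \<in> pinsts n \<Longrightarrow> histogram n (e # es) h' \<Longrightarrow> A e \<longleftrightarrow> B h'"
  shows "(\<exists>e \<in> pinsts n. A e) \<longleftrightarrow> (\<exists>h'. refines (length es) h h' \<and> B h')"
  using assms(2) ex_refines_histogram[OF assms(1)] ex_pinst_histogram[OF _ assms(1)] by metis

lemma length_lookup:
  assumes "x \<in> set xs" "length es = length xs" "set es \<subseteq> pinsts n"
  shows "length (lookup xs es x) = n"
  using lookup_in_set[OF assms(1,2)] assms(3) by (auto simp: pinsts_def)

lemma card_undef_coords:
  assumes "x \<in> set xs" "length es = length xs" "set es \<subseteq> pinsts n"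
  shows "card (undef_coords (lookup xs es x)) = undef_count xs (hist n es) x"
proof -
  let ?B = "{\<tau> \<in> columns (length xs). lookup xs \<tau> x = None}"
  have "undef_coords (lookup xs es x) = {i \<in> {..<n}. column es i \<in> ?B}"
    using assms(2) column_in_columns[of es]
    by (auto simp: undef_coords_def length_lookup[OF assms] lookup_column[OF assms(1,2)])
  also have "card \<dots> = (\<Sum>\<tau> \<in> ?B. card {i \<in> {..<n}. column es i = \<tau>})"
    by (rule sum_card_fibres[symmetric]) simp_all
  finally show ?thesis by (simp add: undef_count_def hist_def)
qed

lemma subsumed_iff_hist:
  assumes "x \<in> set xs" "y \<in> set xs" "length es = length xs" "set es \<subseteq> pinsts n"
  shows "subsumed (lookup xs es x) (lookup xs es y) \<longleftrightarrow> (\<forall>\<tau> \<in> columns (length xs).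
    lookup xs \<tau> x \<noteq> None \<and> lookup xs \<tau> x \<noteq> lookup xs \<tau> y \<longrightarrow> hist n es \<tau> = 0)"
  unfolding assms(3)[symmetric] ball_columns_hist_iff
  using assms by (auto simp: subsumed_def lookup_column length_lookup)

lemma eq_iff_hist:
  assumes "x \<in> set xs" "y \<in> set xs" "length es = length xs" "set es \<subseteq> pinsts n"
  shows "lookup xs es x = lookup xs es y \<longleftrightarrow>
    (\<forall>\<tau> \<in> columns (length xs). lookup xs \<tau> x \<noteq> lookup xs \<tau> y \<longrightarrow> hist n es \<tau> = 0)"
  unfolding assms(3)[symmetric] ball_columns_hist_iff
  using assms by (auto simp: list_eq_iff_nth_eq lookup_column length_lookup)

lemma sat_iff_hist_sat:
  assumes "free_vars \<phi> \<subseteq> set xs" "length es = length xs" "set es \<subseteq> pinsts (dt_dim T)"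
    and "dt_dim T \<le> N" and "histogram (dt_dim T) es h"
  shows "sat T (lookup xs es) \<phi> \<longleftrightarrow> hist_sat N xs h \<phi>"
  using assms
proof (induction \<phi> arbitrary: xs es h)
  case (Subs x y)
  then show ?case
    using subsumed_iff_hist[of x xs y es "dt_dim T"] by (auto simp: histogram_def)
next
  case (Equal x y)
  then show ?case using eq_iff_hist[of x xs y es "dt_dim T"] by (auto simp: histogram_def)
next
  case (Prec x y)
  have "undef_count xs h z = undef_count xs (hist (dt_dim T) es) z" for z
    unfolding undef_count_def using Prec.prems(2,5) by (intro sum.cong) (auto simp: histogram_def)
  then have count: "card (undef_coords (lookup xs es z)) = undef_count xs h z" if "z \<in> {x, y}" for z
    using card_undef_coords[of z xs es "dt_dim T"] Prec.prems that by auto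
  have "undef_coords (lookup xs es y) \<subseteq> {..<dt_dim T}"
    using length_lookup[of y xs es] Prec.prems by (auto simp: undef_coords_def)
  from card_mono[OF _ this] have "undef_count xs h y \<le> N"
    using count[of y] Prec.prems(4) by simp
  then show ?case using count[of x] count[of y] by (simp add: less_defined_def)
next
  case (Exists x \<phi>)
  show ?case
    unfolding sat.simps hist_sat.simps lookup_Cons[symmetric] Exists.prems(2)[symmetric]
    using Exists.prems by (intro ex_pinst_iff_ex_refines Exists.IH) auto
next
  case (Forall x \<phi>)
  have "(\<exists>e \<in> pinsts (dt_dim T). \<not> sat T (lookup (x # xs) (e # es)) \<phi>) \<longleftrightarrow>
      (\<exists>h'. refines (length es) h h' \<and> \<not> hist_sat N (x # xs) h' \<phi>)"
    using Forall.prems by (intro ex_pinst_iff_ex_refines arg_cong[of _ _ Not] Forall.IH) auto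
  then show ?case
    unfolding sat.simps hist_sat.simps lookup_Cons[symmetric] Forall.prems(2)[symmetric] by blast
qed auto

lemma refines_le:
  assumes "refines m h h'" "\<And>\<tau>. h \<tau> \<le> N"
  shows "h' \<tau> \<le> N"
proof (cases "\<tau> \<in> columns (Suc m)")
  case True
  then obtain v \<tau>' where Cons: "\<tau> = v # \<tau>'" "\<tau>' \<in> columns m"
    by (auto simp: columns_def length_Suc_conv)
  then have "h' \<tau> \<le> (\<Sum>v \<in> UNIV. h' (v # \<tau>'))"
    using member_le_sum[of v UNIV "\<lambda>v. h' (v # \<tau>')"] by simp
  also have "\<dots> = h \<tau>'" using assms(1) Cons(2) by (auto simp: refines_def columns_def)
  finally show ?thesis using assms(2) by (rule order_trans)
next
  case False
  then show ?thesis using assms by (simp add: refines_def)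
qed

lemma decidable_ex_refines:
  assumes "decidable P"
  shows "decidable (\<lambda>w h. \<exists>h'. refines m h h' \<and> P w h')"
proof -
  let ?C = "columns (Suc m)"
  let ?Q = "\<lambda>w h. (\<forall>\<tau> \<in> columns m. h \<tau> = (\<Sum>v \<in> UNIV. h (v # \<tau>))) \<and> P w h"
  have "decidable ?Q"
    by (intro decidable_conj decidable_ball_finite decidable_eq computable_var computable_sum
        visible_var assms) auto
  then have "decidable (\<lambda>w h. \<exists>g. (\<forall>\<tau> \<in> ?C. g \<tau> \<le> length w) \<and> ?Q w (override_on h g ?C))"
    by (intro decidable_ex_override_on) auto
  then show ?thesis
  proof (rule decidable_cong, intro iffI)
    fix w :: "'a list" and h :: "pinst \<Rightarrow> nat"
    assume in_range: "\<And>\<tau>. h \<tau> \<le> length w"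
    show "\<exists>h'. refines m h h' \<and> P w h'"
      if "\<exists>g. (\<forall>\<tau> \<in> ?C. g \<tau> \<le> length w) \<and> ?Q w (override_on h g ?C)"
      using that unfolding refines_def
      by (elim exE, intro exI[of _ "override_on h _ ?C"]) (auto simp: columns_def)
    assume "\<exists>h'. refines m h h' \<and> P w h'"
    then obtain h' where refining: "refines m h h'" "P w h'" by blast
    moreover have "override_on h h' ?C = h'"
      using refining(1) by (auto simp: refines_def override_on_def)
    ultimately show "\<exists>g. (\<forall>\<tau> \<in> ?C. g \<tau> \<le> length w) \<and> ?Q w (override_on h g ?C)"
      using refines_le[OF refining(1) in_range] by (intro exI[of _ h']) (auto simp: refines_def)
  qed
qed

lemma decidable_hist_sat: "decidable (\<lambda>(w :: 'a list) h. hist_sat (length w) xs h \<phi>)"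
proof (induction \<phi> arbitrary: xs)
  case (Prec x y)
  have "computable (\<lambda>(w :: 'a list) (h :: pinst \<Rightarrow> nat). undef_count xs h z)" for z
    unfolding undef_count_def by (intro computable_sum computable_var) simp
  then show ?case unfolding hist_sat.simps
    by (intro decidable_subst decidable_le computable_var computable_shift visible_var)
next
  case (Exists x \<phi>)
  show ?case unfolding hist_sat.simps by (intro decidable_ex_refines Exists.IH)
next
  case (Forall x \<phi>)
  have "decidable (\<lambda>(w :: 'a list) h.
      \<not> (\<exists>h'. refines (length xs) h h' \<and> \<not> hist_sat (length w) (x # xs) h' \<phi>))"
    by (intro decidable_not decidable_ex_refines Forall.IH)
  then show ?case by simp
qed (auto intro!: decidable_not decidable_conj decidable_disj decidable_ball_finite decidable_imp
    decidable_const decidable_eq computable_var computable_0 visible_var)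

section \<open>Predicates on the letters of a word\<close>

definition letter_at :: "'a list \<Rightarrow> nat \<Rightarrow> 'a \<Rightarrow> bool" where
  "letter_at w i a \<longleftrightarrow> i < length w \<and> w ! i = a"

lemma letter_at_simps [simp]:
  "\<not> letter_at [] i a"
  "letter_at (x # u) 0 a \<longleftrightarrow> x = a"
  "letter_at (x # u) (Suc i) a \<longleftrightarrow> letter_at u i a"
  by (auto simp: letter_at_def)

lemma letter_at_drop: "letter_at (drop b w) i a \<longleftrightarrow> letter_at w (b + i) a"
  by (auto simp: letter_at_def)

lemma ex_letter_at_Cons:
  "(\<exists>i. letter_at (x # u) i a \<and> P i) \<longleftrightarrow> x = a \<and> P 0 \<or> (\<exists>i. letter_at u i a \<and> P (Suc i))"
  by (metis letter_at_simps(2,3) not0_implies_Suc)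

lemma letter_at_less: "letter_at w i a \<Longrightarrow> i < length w"
  by (simp add: letter_at_def)

lemma decidable_letter_at:
  assumes "computable t"
  shows "decidable (\<lambda>w s. letter_at w (t w s) a)"
proof -
  have "decidable (\<lambda>w s. letter_at w (s None) a)"
    unfolding letter_at_def by (rule decidable_letter)
  with assms have "decidable (\<lambda>w s. t w s \<le> length w \<and> letter_at w (t w s) a)"
    by (rule decidable_subst)
  then show ?thesis by (rule decidable_cong) (auto dest: letter_at_less)
qed

lemma decidable_letter_at_drop:
  "computable b \<Longrightarrow> computable t \<Longrightarrow> decidable (\<lambda>w s. letter_at (drop (b w s) w) (t w s) a)"
  unfolding letter_at_drop by (intro decidable_letter_at computable_add)

lemma decidable_ex_letter_at_drop:
  fixes b :: "'a list \<Rightarrow> ('v \<Rightarrow> nat) \<Rightarrow> nat"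
  assumes "computable b" "decidable (bind_var P)"
  shows "decidable (\<lambda>w s. \<exists>i. letter_at (drop (b w s) w) i a \<and> P w s i)"
proof (rule decidable_cong)
  show "decidable (\<lambda>w s. \<exists>i \<le> length w. letter_at (drop (b w s) w) i a \<and> P w s i)"
    using assms(2)
    by (intro decidable_ex decidable_conj decidable_letter_at_drop computable_var
        computable_shift assms(1))
next
  fix w :: "'a list" and s :: "'v \<Rightarrow> nat"
  have "i \<le> length w" if "letter_at (drop (b w s) w) i a" for i
    using letter_at_less[OF that] by simp
  then show "(\<exists>i \<le> length w. letter_at (drop (b w s) w) i a \<and> P w s i) \<longleftrightarrow>
      (\<exists>i. letter_at (drop (b w s) w) i a \<and> P w s i)" by blast
qed

definition occ :: "'a set \<Rightarrow> 'a list \<Rightarrow> nat \<Rightarrow> nat" where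
  "occ S u r = card {i. i < r \<and> (\<exists>a \<in> S. letter_at u i a)}"

lemma occ_simps [simp]:
  "occ S u 0 = 0"
  "occ S [] r = 0"
  "occ S (x # u) (Suc r) = of_bool (x \<in> S) + occ S u r"
proof -
  let ?A = "\<lambda>u r. {i. i < r \<and> (\<exists>a \<in> S. letter_at u i a)}"
  have "i \<in> ?A (x # u) (Suc r) \<longleftrightarrow> i \<in> (if x \<in> S then {0} else {}) \<union> Suc ` ?A u r" for i
    by (cases i) auto
  then have "?A (x # u) (Suc r) = (if x \<in> S then {0} else {}) \<union> Suc ` ?A u r" by blast
  then show "occ S (x # u) (Suc r) = of_bool (x \<in> S) + occ S u r"
    by (simp add: occ_def card_image card_insert_if image_iff)
qed (simp_all add: occ_def)

lemma computable_occ_drop: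
  assumes "computable b" "computable r" "visible r" "finite S"
  shows "computable (\<lambda>w s. occ S (drop (b w s) w) (r w s))"
  unfolding occ_def
  by (intro computable_card_less decidable_bex_finite decidable_letter_at_drop computable_var
      computable_shift assms)

lemma visible_occ_drop: "visible r \<Longrightarrow> visible (\<lambda>w s. occ S (drop (b w s) w) (r w s))"
  unfolding occ_def by (rule visible_card_less)

section \<open>Encodings of decision trees\<close>

abbreviation leaf_letters :: "sym set" where
  "leaf_letters \<equiv> {LeafTrue, LeafFalse}"

text \<open>
  A one-counter automaton for preorder encodings: \<open>m\<close> trees remain to be read, and \<open>b\<close> tells
  whether a tally is admissible.
\<close>

fun accepts :: "bool \<Rightarrow> nat \<Rightarrow> sym list \<Rightarrow> bool" where
  "accepts b m [] \<longleftrightarrow> m = 0"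
| "accepts b m (x # u) \<longleftrightarrow> m > 0 \<and>
     (if x = Inner then accepts True (Suc m) u
      else if x = Tally then b \<and> accepts b m u
      else x \<in> leaf_letters \<and> accepts False (m - 1) u)"

lemma accepts_imp_encoding:
  assumes "accepts b m u"
  shows "\<exists>i ts. length ts = m \<and> (i = 0 \<or> b) \<and> u = replicate i Tally @ concat (map encode_btree ts)"
  using assms
proof (induction u arbitrary: b m)
  case (Cons x u)
  then consider (inner) "x = Inner" "accepts True (Suc m) u"
    | (tally) "x = Tally" "b" "accepts b m u"
    | (leaf) "x \<in> leaf_letters" "accepts False (m - 1) u"
    by (auto split: if_splits)
  then show ?case
  proof cases
    case inner
    obtain i ts where trees: "length ts = Suc m"
        "u = replicate i Tally @ concat (map encode_btree ts)"
      using Cons.IH[OF inner(2)] by blast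
    obtain t0 t1 ts' where "ts = t0 # t1 # ts'"
      using trees(1) Cons.prems by (cases ts; cases "tl ts") auto
    then show ?thesis
      using trees inner(1) by (intro exI[of _ 0] exI[of _ "Node i t0 t1 # ts'"]) simp
  next
    case tally
    then show ?thesis using Cons.IH[OF tally(3)] by (metis append_Cons replicate_Suc)
  next
    case leaf
    then obtain ts where "length ts = m - 1" "u = concat (map encode_btree ts)"
      using Cons.IH[OF leaf(2)] by auto
    then show ?thesis
      using leaf(1) Cons.prems
      by (intro exI[of _ 0] exI[of _ "Leaf (x = LeafTrue) # ts"]) auto
  qed
qed simp

lemma accepts_True: "accepts b m u \<Longrightarrow> accepts True m u"
  by (induction b m u rule: accepts.induct) (auto split: if_splits)

lemma accepts_tallies: "m > 0 \<Longrightarrow> accepts True m u \<Longrightarrow> accepts True m (replicate i Tally @ u)"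
  by (induction i) auto

lemma accepts_encode_btree: "accepts False m u \<Longrightarrow> accepts False (Suc m) (encode_btree t @ u)"
proof (induction t arbitrary: m u)
  case (Node i t0 t1)
  have "accepts False (Suc (Suc m)) (encode_btree t0 @ encode_btree t1 @ u)"
    by (intro Node.IH Node.prems)
  then show ?case by (auto intro: accepts_tallies accepts_True)
qed simp

lemma accepts_iff_encoding: "accepts False 1 u \<longleftrightarrow> (\<exists>t. u = encode_btree t)"
proof
  assume "accepts False 1 u"
  then show "\<exists>t. u = encode_btree t"
    using accepts_imp_encoding[of False 1 u] by (auto simp: length_Suc_conv)
next
  assume "\<exists>t. u = encode_btree t"
  then show "accepts False 1 u" using accepts_encode_btree[of 0 "[]"] by auto
qed

text \<open>The counter of the automaton stays positive while the first \<open>q\<close> letters are read.\<close>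

definition unfinished :: "nat \<Rightarrow> sym list \<Rightarrow> nat \<Rightarrow> bool" where
  "unfinished m u q \<longleftrightarrow> (\<forall>r \<le> q. occ leaf_letters u r < m + occ {Inner} u r)"

lemma all_le_Suc_iff: "(\<forall>r \<le> Suc q. P r) \<longleftrightarrow> P 0 \<and> (\<forall>r \<le> q. P (Suc r))"
  using All_less_Suc2[of "Suc q" P] by (simp add: less_Suc_eq_le)

lemma unfinished_0 [simp]: "unfinished m u 0 \<longleftrightarrow> m > 0"
  by (simp add: unfinished_def)

lemma unfinished_Suc:
  "unfinished m (x # u) (Suc q) \<longleftrightarrow> m > 0 \<and>
     unfinished (if x = Inner then Suc m else if x \<in> leaf_letters then m - 1 else m) u q"
  by (cases m) (auto simp: unfinished_def all_le_Suc_iff)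

definition tally_admissible :: "bool \<Rightarrow> sym list \<Rightarrow> nat \<Rightarrow> bool" where
  "tally_admissible b u i \<longleftrightarrow>
     (case i of 0 \<Rightarrow> b | Suc j \<Rightarrow> \<exists>a \<in> {Inner, Tally}. letter_at u j a)"

lemma tally_admissible_0 [simp]: "tally_admissible b u 0 = b"
  by (simp add: tally_admissible_def)

lemma tally_admissible_Suc:
  "tally_admissible b (x # u) (Suc i) = tally_admissible (x \<in> {Inner, Tally}) u i"
  by (cases i) (auto simp: tally_admissible_def)

definition forest_prefix :: "bool \<Rightarrow> nat \<Rightarrow> sym list \<Rightarrow> nat \<Rightarrow> bool" where
  "forest_prefix b m u l \<longleftrightarrow>
     (\<forall>i < l. (\<exists>a \<in> {Inner, Tally, LeafTrue, LeafFalse}. letter_at u i a) \<and> unfinished m u i \<and>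
        (letter_at u i Tally \<longrightarrow> tally_admissible b u i)) \<and>
     occ leaf_letters u l = m + occ {Inner} u l"

lemma forest_prefix_Nil: "forest_prefix b m [] l \<longleftrightarrow> l = 0 \<and> m = 0"
  by (auto simp: forest_prefix_def)

lemma forest_prefix_Cons:
  "forest_prefix b m (x # u) (Suc l) \<longleftrightarrow> m > 0 \<and>
     (if x = Inner then forest_prefix True (Suc m) u l
      else if x = Tally then b \<and> forest_prefix b m u l
      else x \<in> leaf_letters \<and> forest_prefix False (m - 1) u l)"
proof (cases "m > 0")
  case True
  then obtain k where "m = Suc k" by (cases m) auto
  then show ?thesis
    by (cases x)
      (auto simp: forest_prefix_def All_less_Suc2 unfinished_Suc tally_admissible_Suc)
qed (auto simp: forest_prefix_def)

lemma forest_prefix_iff_accepts: "forest_prefix b m u l \<longleftrightarrow> l \<le> length u \<and> accepts b m (take l u)"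
proof (induction l arbitrary: b m u)
  case (Suc l)
  then show ?case by (cases u) (auto simp: forest_prefix_Nil forest_prefix_Cons)
qed (simp add: forest_prefix_def)

definition leading_tallies :: "sym list \<Rightarrow> nat" where
  "leading_tallies u = length (takeWhile (\<lambda>x. x = Tally) u)"

lemma leading_tallies_simps [simp]:
  "leading_tallies [] = 0"
  "leading_tallies (x # u) = (if x = Tally then Suc (leading_tallies u) else 0)"
  by (simp_all add: leading_tallies_def)

lemma leading_tallies_le: "leading_tallies u \<le> length u"
  by (simp add: leading_tallies_def length_takeWhile_le)

lemma leading_tallies_eq_iff:
  "leading_tallies u = f \<longleftrightarrow> (\<forall>j < f. letter_at u j Tally) \<and> \<not> letter_at u f Tally"
proof (induction u arbitrary: f)
  case (Cons x u)
  then show ?case by (cases f) (auto simp: All_less_Suc2)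
qed (cases f; auto)

lemma leading_tallies_encode: "leading_tallies (replicate i Tally @ encode_btree t @ u) = i"
  by (induction i) (cases t; auto)+

text \<open>The features in the first \<open>m\<close> trees of a sequence of encoded trees.\<close>

definition word_features :: "nat \<Rightarrow> sym list \<Rightarrow> nat set" where
  "word_features m u =
     {leading_tallies (drop (Suc q) u) | q. letter_at u q Inner \<and> unfinished m u q}"

lemma in_word_features_iff:
  "f \<in> word_features m u \<longleftrightarrow>
     (\<exists>q. letter_at u q Inner \<and> unfinished m u q \<and> leading_tallies (drop (Suc q) u) = f)"
  by (auto simp: word_features_def)

lemma word_features_Cons:
  "word_features m (x # u) =
     (if m = 0 then {}
      else if x = Inner then insert (leading_tallies u) (word_features (Suc m) u)
      else word_features (if x \<in> leaf_letters then m - 1 else m) u)"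
  by (intro set_eqI)
    (auto simp: in_word_features_iff ex_letter_at_Cons unfinished_Suc)

lemma word_features_0 [simp]: "word_features 0 u = {}"
  by (auto simp: word_features_def unfinished_def)

lemma word_features_tallies [simp]: "word_features m (replicate i Tally @ u) = word_features m u"
  by (induction i) (auto simp: word_features_Cons)

lemma word_features_encode:
  "word_features (Suc m) (encode_btree t @ u) = features t \<union> word_features m u"
proof (induction t arbitrary: m u)
  case (Node i t0 t1)
  have "word_features (Suc m) (encode_btree (Node i t0 t1) @ u) =
    insert i (word_features (Suc (Suc m)) (encode_btree t0 @ encode_btree t1 @ u))"
    by (simp add: word_features_Cons leading_tallies_encode)
  then show ?case by (simp add: Node Un_assoc)
qed (simp add: word_features_Cons)

definition no_repeat :: "sym list \<Rightarrow> bool" where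
  "no_repeat u \<longleftrightarrow> \<not> (\<exists>q. letter_at u q Inner \<and>
     leading_tallies (drop (Suc q) u) \<in> word_features 2 (drop (Suc q) u))"

lemma no_repeat_Cons:
  "no_repeat (x # u) \<longleftrightarrow> (x = Inner \<longrightarrow> leading_tallies u \<notin> word_features 2 u) \<and> no_repeat u"
  by (auto simp: no_repeat_def ex_letter_at_Cons)

lemma no_repeat_tallies [simp]: "no_repeat (replicate i Tally @ u) = no_repeat u"
  by (induction i) (auto simp: no_repeat_Cons)

lemma features_eq_paths: "features t = (\<Union>p \<in> paths t. set p)"
proof -
  have "paths t \<noteq> {}" for t by (induction t) auto
  then show ?thesis by (induction t) auto
qed

lemma distinct_paths_Node:
  "(\<forall>p \<in> paths (Node i t0 t1). distinct p) \<longleftrightarrow> i \<notin> features t0 \<union> features t1 \<and>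
     (\<forall>p \<in> paths t0. distinct p) \<and> (\<forall>p \<in> paths t1. distinct p)"
  by (auto simp: features_eq_paths)

lemma no_repeat_encode:
  "no_repeat (encode_btree t @ u) \<longleftrightarrow> (\<forall>p \<in> paths t. distinct p) \<and> no_repeat u"
proof (induction t arbitrary: u)
  case (Node i t0 t1)
  have "word_features 2 (encode_btree t0 @ encode_btree t1 @ u) = features t0 \<union> features t1"
    by (simp add: word_features_encode numeral_2_eq_2)
  then show ?case
    unfolding distinct_paths_Node by (simp add: Node leading_tallies_encode no_repeat_Cons)
qed (auto simp: no_repeat_Cons)

lemma no_repeat_if_no_Inner: "Inner \<notin> set u \<Longrightarrow> no_repeat u"
  by (auto simp: no_repeat_def letter_at_def in_set_conv_nth)

subsection \<open>Decidability\<close>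

lemma decidable_unfinished_drop:
  assumes "computable b" "computable q" "visible q"
  shows "decidable (\<lambda>w s. unfinished m (drop (b w s) w) (q w s))"
  unfolding unfinished_def
  by (intro decidable_all_le decidable_less computable_occ_drop computable_add computable_const
      computable_var computable_shift visible_occ_drop visible_var assms) auto

lemma decidable_tally_admissible_drop:
  fixes b i :: "sym list \<Rightarrow> ('v \<Rightarrow> nat) \<Rightarrow> nat"
  assumes "computable b" "computable i" "visible i"
  shows "decidable (\<lambda>w s. tally_admissible c (drop (b w s) w) (i w s))"
proof (rule decidable_cong)
  show "decidable (\<lambda>w s. i w s = 0 \<and> c \<or>
      (\<exists>j \<le> length w. i w s = Suc j \<and> (\<exists>a \<in> {Inner, Tally}. letter_at (drop (b w s) w) j a)))"
    by (intro decidable_disj decidable_conj decidable_const decidable_ex decidable_eq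
        decidable_bex_finite decidable_letter_at_drop computable_0 computable_Suc computable_var
        computable_shift visible_shift assms) auto
next
  fix w :: "sym list" and s :: "'v \<Rightarrow> nat"
  assume "\<And>v. s v \<le> length w"
  then have "i w s \<le> length w" by (rule visibleD[OF assms(3)])
  then show "i w s = 0 \<and> c \<or>
      (\<exists>j \<le> length w. i w s = Suc j \<and> (\<exists>a \<in> {Inner, Tally}. letter_at (drop (b w s) w) j a)) \<longleftrightarrow>
      tally_admissible c (drop (b w s) w) (i w s)"
    by (auto simp: tally_admissible_def split: nat.split)
qed

lemma decidable_forest_prefix_drop:
  assumes "computable b" "computable l" "visible l"
  shows "decidable (\<lambda>w s. forest_prefix c m (drop (b w s) w) (l w s))"
  unfolding forest_prefix_def
  by (intro decidable_conj decidable_all_less decidable_bex_finite decidable_imp decidable_eq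
      decidable_letter_at_drop decidable_unfinished_drop decidable_tally_admissible_drop
      computable_occ_drop computable_add computable_const computable_var computable_shift
      visible_occ_drop visible_var assms) auto

lemma computable_leading_tallies_drop:
  assumes "computable b"
  shows "computable (\<lambda>w s. leading_tallies (drop (b w s) w))"
  unfolding computable_def leading_tallies_eq_iff
  by (intro decidable_conj decidable_all_less decidable_not decidable_letter_at_drop computable_var
      computable_shift visible_var assms)

lemma visible_leading_tallies_drop: "visible (\<lambda>w s. leading_tallies (drop (b w s) w))"
  by (simp add: visible_def order_trans[OF leading_tallies_le])

lemma decidable_in_word_features_drop:
  assumes "computable b" "computable f"
  shows "decidable (\<lambda>w s. f w s \<in> word_features m (drop (b w s) w))"
proof -
  have "f w s \<in> word_features m (drop (b w s) w) \<longleftrightarrow> (\<exists>q. letter_at (drop (b w s) w) q Inner \<and>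
      unfinished m (drop (b w s) w) q \<and> leading_tallies (drop (Suc q + b w s) w) = f w s)" for w s
    by (simp add: in_word_features_iff)
  then show ?thesis
    by (simp only:) (intro decidable_ex_letter_at_drop decidable_conj decidable_unfinished_drop
      decidable_eq computable_leading_tallies_drop computable_add computable_Suc computable_var
      computable_shift visible_leading_tallies_drop visible_var assms)
qed

lemma decidable_word_features_drop_subset:
  fixes b n :: "sym list \<Rightarrow> ('v \<Rightarrow> nat) \<Rightarrow> nat"
  assumes "computable b" "computable n"
  shows "decidable (\<lambda>w s. word_features m (drop (b w s) w) \<subseteq> {1..n w s})"
proof (rule decidable_cong)
  show "decidable (\<lambda>w s. \<forall>f \<le> length w. f \<in> word_features m (drop (b w s) w) \<longrightarrow> 0 < f \<and> f \<le> n w s)"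
    by (intro decidable_all decidable_imp decidable_conj decidable_in_word_features_drop
        decidable_less decidable_le computable_var computable_0 computable_shift visible_0
        visible_var assms)
next
  fix w :: "sym list" and s :: "'v \<Rightarrow> nat"
  have "f \<le> length w" if "f \<in> word_features m (drop (b w s) w)" for f
    using that by (auto simp: word_features_def intro: order_trans[OF leading_tallies_le])
  then show "(\<forall>f \<le> length w. f \<in> word_features m (drop (b w s) w) \<longrightarrow> 0 < f \<and> f \<le> n w s) \<longleftrightarrow>
      word_features m (drop (b w s) w) \<subseteq> {1..n w s}"
    by (auto simp: Suc_le_eq)
qed

lemma decidable_no_repeat_drop:
  assumes "computable b"
  shows "decidable (\<lambda>w s. no_repeat (drop (b w s) w))"
proof -
  have "no_repeat (drop (b w s) w) \<longleftrightarrow> \<not> (\<exists>q. letter_at (drop (b w s) w) q Inner \<and>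
      leading_tallies (drop (Suc q + b w s) w) \<in> word_features 2 (drop (Suc q + b w s) w))" for w s
    by (auto simp: no_repeat_def)
  then show ?thesis
    by (simp only:) (intro decidable_not decidable_ex_letter_at_drop decidable_in_word_features_drop
      computable_leading_tallies_drop computable_add computable_Suc computable_var computable_shift
      assms)
qed

section \<open>Encodings of partial instances\<close>

abbreviation encode_pinsts :: "pinst list \<Rightarrow> sym list" where
  "encode_pinsts es \<equiv> concat (map (\<lambda>e. Sep # encode_pinst e) es)"

definition pinst_prefix :: "nat \<Rightarrow> sym list \<Rightarrow> bool" where
  "pinst_prefix n u \<longleftrightarrow> letter_at u 0 Sep \<and> (\<forall>i < n. \<exists>a \<in> {Zero, One, Bot}. letter_at u (Suc i) a)"

fun pinsts_word :: "nat \<Rightarrow> nat \<Rightarrow> sym list \<Rightarrow> bool" where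
  "pinsts_word n 0 u \<longleftrightarrow> u = []"
| "pinsts_word n (Suc k) u \<longleftrightarrow> pinst_prefix n u \<and> pinsts_word n k (drop (Suc n) u)"

fun column_at :: "nat \<Rightarrow> sym list \<Rightarrow> pinst \<Rightarrow> nat \<Rightarrow> bool" where
  "column_at n u [] i \<longleftrightarrow> True"
| "column_at n u (v # \<tau>) i \<longleftrightarrow>
     letter_at u (Suc i) (encode_value v) \<and> column_at n (drop (Suc n) u) \<tau> i"

definition word_hist :: "nat \<Rightarrow> nat \<Rightarrow> sym list \<Rightarrow> pinst \<Rightarrow> nat" where
  "word_hist k n u \<tau> = (if \<tau> \<in> columns k then card {i. i < n \<and> column_at n u \<tau> i} else 0)"

lemma length_encode_pinst [simp]: "length (encode_pinst e) = length e"
  by (simp add: encode_pinst_def)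

lemma encode_value_inject: "encode_value a = encode_value b \<longleftrightarrow> a = b"
  by (cases a; cases b) auto

lemma encode_value_range: "encode_value v \<in> {Zero, One, Bot}"
  by (cases v) auto

lemma ex_encode_pinst: "set u \<subseteq> {Zero, One, Bot} \<Longrightarrow> \<exists>e. u = encode_pinst e"
proof (induction u)
  case (Cons x u)
  then obtain e where "u = encode_pinst e" by auto
  moreover have "x = encode_value (if x = Bot then None else Some (x = One))"
    using Cons.prems by auto
  ultimately have "x # u = encode_pinst ((if x = Bot then None else Some (x = One)) # e)"
    by (simp add: encode_pinst_def)
  then show ?case ..
qed (simp add: encode_pinst_def)

lemma letter_at_encode_pinst:
  "letter_at (encode_pinst e @ u) i (encode_value v) \<longleftrightarrow> e ! i = v" if "i < length e"
  using that by (auto simp: letter_at_def encode_pinst_def nth_append encode_value_inject)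

lemma pinst_prefix_iff:
  "pinst_prefix n u \<longleftrightarrow> (\<exists>e \<in> pinsts n. u = Sep # encode_pinst e @ drop (Suc n) u)"
proof
  assume prefix: "pinst_prefix n u"
  then obtain u' where Sep: "u = Sep # u'"
    by (cases u) (auto simp: pinst_prefix_def)
  then have letters: "i < length u' \<and> u' ! i \<in> {Zero, One, Bot}" if "i < n" for i
    using prefix that by (auto simp: pinst_prefix_def letter_at_def)
  then have "n \<le> length u'" by (meson not_le_imp_less order_less_irrefl)
  moreover have "set (take n u') \<subseteq> {Zero, One, Bot}"
    using letters by (fastforce simp: in_set_conv_nth)
  then obtain e where decoded: "take n u' = encode_pinst e" using ex_encode_pinst by blast
  ultimately have "length (encode_pinst e) = n" by (simp flip: decoded)
  then have "e \<in> pinsts n" by (simp add: pinsts_def)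
  have "u = Sep # encode_pinst e @ drop (Suc n) u" by (simp add: Sep flip: decoded)
  with \<open>e \<in> pinsts n\<close> show "\<exists>e \<in> pinsts n. u = Sep # encode_pinst e @ drop (Suc n) u" ..
next
  assume "\<exists>e \<in> pinsts n. u = Sep # encode_pinst e @ drop (Suc n) u"
  then obtain e where split: "length e = n" "u = Sep # encode_pinst e @ drop (Suc n) u"
    by (auto simp: pinsts_def)
  have "letter_at u (Suc i) (encode_value (e ! i))" if "i < n" for i
    by (subst split(2)) (simp add: letter_at_encode_pinst split(1) that)
  moreover have "letter_at u 0 Sep" by (subst split(2)) simp
  ultimately show "pinst_prefix n u"
    using encode_value_range unfolding pinst_prefix_def by blast
qed

lemma pinsts_word_iff:
  "pinsts_word n k u \<longleftrightarrow> (\<exists>es. length es = k \<and> set es \<subseteq> pinsts n \<and> u = encode_pinsts es)"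
proof (induction k arbitrary: u)
  case (Suc k)
  show ?case
  proof
    assume "pinsts_word n (Suc k) u"
    then obtain e es where "e \<in> pinsts n" "u = Sep # encode_pinst e @ drop (Suc n) u"
        "length es = k" "set es \<subseteq> pinsts n" "drop (Suc n) u = encode_pinsts es"
      using Suc.IH by (auto simp: pinst_prefix_iff)
    then show "\<exists>es. length es = Suc k \<and> set es \<subseteq> pinsts n \<and> u = encode_pinsts es"
      by (intro exI[of _ "e # es"]) auto
  next
    assume "\<exists>es. length es = Suc k \<and> set es \<subseteq> pinsts n \<and> u = encode_pinsts es"
    then obtain e es where split: "e \<in> pinsts n" "length es = k" "set es \<subseteq> pinsts n"
        "u = Sep # encode_pinst e @ encode_pinsts es"
      by (auto simp: length_Suc_conv)
    then have "drop (Suc n) u = encode_pinsts es" by (simp add: pinsts_def)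
    then show "pinsts_word n (Suc k) u" using split Suc.IH by (auto simp: pinst_prefix_iff)
  qed
qed auto

lemma column_at_iff:
  assumes "set es \<subseteq> pinsts n" "length \<tau> = length es" "i < n"
  shows "column_at n (encode_pinsts es) \<tau> i \<longleftrightarrow> column es i = \<tau>"
  using assms(1,2)
proof (induction es arbitrary: \<tau>)
  case (Cons e es)
  then obtain v \<tau>' where \<tau>: "\<tau> = v # \<tau>'" by (cases \<tau>) auto
  have "length e = n" using Cons.prems(1) by (simp add: pinsts_def)
  then show ?case
    using Cons.IH[of \<tau>'] Cons.prems \<tau> assms(3) by (simp add: letter_at_encode_pinst column_def)
qed (simp add: column_def)

lemma word_hist_encode_pinsts:
  assumes "set es \<subseteq> pinsts n"
  shows "word_hist (length es) n (encode_pinsts es) = hist n es"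
proof
  fix \<tau>
  show "word_hist (length es) n (encode_pinsts es) \<tau> = hist n es \<tau>"
  proof (cases "\<tau> \<in> columns (length es)")
    case True
    then have "column_at n (encode_pinsts es) \<tau> i \<longleftrightarrow> column es i = \<tau>" if "i < n" for i
      using column_at_iff[OF assms] that by (simp add: columns_def)
    then show ?thesis using True by (simp add: word_hist_def hist_def cong: conj_cong)
  next
    case False
    then have "column es i \<noteq> \<tau>" for i using column_in_columns[of es i] by metis
    then show ?thesis using False by (simp add: word_hist_def hist_def)
  qed
qed

lemma decidable_pinsts_word_drop:
  assumes "computable n" "visible n" "computable q"
  shows "decidable (\<lambda>w s. pinsts_word (n w s) k (drop (q w s) w))"
  using assms(3)
proof (induction k arbitrary: q)
  case 0
  have "decidable (\<lambda>(w :: sym list) s. length w \<le> q w s)"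
    by (intro decidable_le computable_length visible_length 0)
  then show ?case by simp
next
  case (Suc k)
  show ?case
    unfolding pinsts_word.simps pinst_prefix_def drop_drop
    by (intro decidable_conj decidable_letter_at_drop decidable_all_less decidable_bex_finite
        Suc.IH computable_add computable_Suc computable_0 computable_var computable_shift
        Suc.prems assms(1,2)) auto
qed

lemma decidable_column_at_drop:
  assumes "computable n" "computable q" "computable i"
  shows "decidable (\<lambda>w s. column_at (n w s) (drop (q w s) w) \<tau> (i w s))"
  using assms(2)
proof (induction \<tau> arbitrary: q)
  case (Cons v \<tau>)
  show ?case
    unfolding column_at.simps drop_drop
    by (intro decidable_conj decidable_letter_at_drop computable_add computable_Suc Cons assms(1,3))
qed (simp add: decidable_const)

section \<open>The evaluation problem\<close>

text \<open>
  Here \<open>n\<close> is the dimension and \<open>l\<close> the length of the encoding of the tree, which starts at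
  position \<open>Suc n\<close>.
\<close>

definition input_word :: "nat \<Rightarrow> sym list \<Rightarrow> nat \<Rightarrow> nat \<Rightarrow> bool" where
  "input_word k w n l \<longleftrightarrow>
     (\<forall>i < n. letter_at w i Tally) \<and> letter_at w n Sep \<and>
     forest_prefix False 1 (drop (Suc n) w) l \<and>
     word_features 1 (drop (Suc n) w) \<subseteq> {1..n} \<and> no_repeat (drop (Suc n) w) \<and>
     pinsts_word n k (drop (Suc n + l) w)"

lemma tallies_Sep_prefix_iff:
  "(\<forall>i < n. letter_at w i Tally) \<and> letter_at w n Sep \<longleftrightarrow>
     w = replicate n Tally @ Sep # drop (Suc n) w"
proof (induction n arbitrary: w)
  case 0
  then show ?case by (cases w) auto
next
  case (Suc n)
  then show ?case by (cases w) (auto simp: All_less_Suc2)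
qed

lemma decision_tree_iff_word:
  "decision_tree T \<longleftrightarrow>
     word_features 1 (encode_btree (dt_tree T) @ encode_pinsts es) \<subseteq> {1..dt_dim T} \<and>
     no_repeat (encode_btree (dt_tree T) @ encode_pinsts es)"
proof -
  have "Inner \<noteq> encode_value v" for v by (cases v) auto
  then have "no_repeat (encode_pinsts es)"
    by (intro no_repeat_if_no_Inner) (auto simp: encode_pinst_def)
  then show ?thesis
    by (simp add: decision_tree_def word_features_encode no_repeat_encode)
qed

lemma input_word_imp_encode:
  assumes word: "input_word k w n l"
  shows "\<exists>T es. w = encode T es \<and> decision_tree T \<and> length es = k \<and> set es \<subseteq> pinsts (dt_dim T) \<and>
    n = dt_dim T \<and> l = length (encode_btree (dt_tree T))"
proof -
  have prefix: "w = replicate n Tally @ Sep # drop (Suc n) w"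
    using word tallies_Sep_prefix_iff by (auto simp: input_word_def)
  obtain t where tree: "l \<le> length (drop (Suc n) w)" "take l (drop (Suc n) w) = encode_btree t"
    using word forest_prefix_iff_accepts accepts_iff_encoding by (auto simp: input_word_def)
  obtain es where insts: "length es = k" "set es \<subseteq> pinsts n"
      "drop (Suc n + l) w = encode_pinsts es"
    using word by (auto simp: input_word_def pinsts_word_iff)
  define T where "T = \<lparr>dt_dim = n, dt_tree = t\<rparr>"
  have rest: "drop (Suc n) w = encode_btree (dt_tree T) @ encode_pinsts es"
    using tree(2) insts(3)
    by (metis append_take_drop_id drop_drop add.commute T_def dtree.select_convs(2))
  then have "decision_tree T"
    using word unfolding decision_tree_iff_word[of T es] by (simp add: input_word_def T_def)
  moreover have "w = encode T es" using prefix rest by (simp add: encode_def T_def)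
  moreover have "l = length (encode_btree (dt_tree T))"
    using tree by (metis length_take min.absorb2 T_def dtree.select_convs(2))
  ultimately show ?thesis using insts by (intro exI[of _ T] exI[of _ es]) (simp add: T_def)
qed

lemma input_word_encode:
  assumes "decision_tree T" "set es \<subseteq> pinsts (dt_dim T)"
  shows "input_word (length es) (encode T es) (dt_dim T) (length (encode_btree (dt_tree T)))"
proof -
  let ?w = "encode T es" and ?n = "dt_dim T" and ?l = "length (encode_btree (dt_tree T))"
  have rest: "drop (Suc ?n) ?w = encode_btree (dt_tree T) @ encode_pinsts es"
    by (simp add: encode_def)
  have "forest_prefix False 1 (drop (Suc ?n) ?w) ?l"
    unfolding forest_prefix_iff_accepts accepts_iff_encoding rest by auto
  moreover have "(\<forall>i < ?n. letter_at ?w i Tally) \<and> letter_at ?w ?n Sep"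
    unfolding tallies_Sep_prefix_iff rest by (simp add: encode_def)
  moreover have "drop (Suc ?n + ?l) ?w = encode_pinsts es" by (simp add: encode_def)
  ultimately show ?thesis
    using assms
    unfolding input_word_def decision_tree_iff_word[of T es] rest[symmetric] pinsts_word_iff
    by metis
qed

lemma models_iff_hist_sat:
  assumes "free_vars \<phi> \<subseteq> set xs" "length es = length xs" "set es \<subseteq> pinsts (dt_dim T)"
  shows "models T \<phi> xs es \<longleftrightarrow> hist_sat (length (encode T es)) xs (hist (dt_dim T) es) \<phi>"
proof -
  have "dt_dim T \<le> length (encode T es)" by (simp add: encode_def)
  then have "sat T (lookup xs es) \<phi> \<longleftrightarrow> hist_sat (length (encode T es)) xs (hist (dt_dim T) es) \<phi>"
    using assms by (intro sat_iff_hist_sat) (auto simp: histogram_def)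
  then show ?thesis by (simp add: models_def lookup_def[abs_def])
qed

definition eval_word :: "fo \<Rightarrow> nat list \<Rightarrow> sym list \<Rightarrow> nat \<Rightarrow> nat \<Rightarrow> bool" where
  "eval_word \<phi> xs w n l \<longleftrightarrow> input_word (length xs) w n l \<and>
     hist_sat (length w) xs (word_hist (length xs) n (drop (Suc n + l) w)) \<phi>"

lemma eval_word_iff:
  assumes "free_vars \<phi> \<subseteq> set xs"
  shows "eval_word \<phi> xs w n l \<longleftrightarrow> (\<exists>T es. w = encode T es \<and> decision_tree T \<and>
    length es = length xs \<and> set es \<subseteq> pinsts (dt_dim T) \<and> models T \<phi> xs es \<and>
    n = dt_dim T \<and> l = length (encode_btree (dt_tree T)))"
proof -
  have "models T \<phi> xs es \<longleftrightarrow> hist_sat (length (encode T es)) xs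
      (word_hist (length xs) (dt_dim T)
        (drop (Suc (dt_dim T) + length (encode_btree (dt_tree T))) (encode T es))) \<phi>"
    if insts: "length es = length xs" "set es \<subseteq> pinsts (dt_dim T)" for T es
  proof -
    have "drop (Suc (dt_dim T) + length (encode_btree (dt_tree T))) (encode T es) =
        encode_pinsts es"
      by (simp add: encode_def)
    then show ?thesis
      unfolding models_iff_hist_sat[OF assms insts] insts(1)[symmetric]
        word_hist_encode_pinsts[OF insts(2), symmetric]
      by (simp only:)
  qed
  then show ?thesis
    unfolding eval_word_def using input_word_imp_encode[of "length xs" w n l] input_word_encode
    by metis
qed

lemma in_Eval_iff:
  assumes "free_vars \<phi> \<subseteq> set xs"
  shows "w \<in> Eval \<phi> xs \<longleftrightarrow> (\<exists>n \<le> length w. \<exists>l \<le> length w. eval_word \<phi> xs w n l)"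
proof -
  have "dt_dim T \<le> length (encode T es)" "length (encode_btree (dt_tree T)) \<le> length (encode T es)"
    for T es by (simp_all add: encode_def)
  then show ?thesis unfolding Eval_def eval_word_iff[OF assms] by blast
qed

lemma decidable_eval_word: "decidable (\<lambda>w s. \<exists>n \<le> length w. \<exists>l \<le> length w. eval_word \<phi> xs w n l)"
proof -
  have "decidable (\<lambda>(w :: sym list) s. hist_sat (length w) xs
      (word_hist (length xs) (s x) (drop (Suc (s x) + s y) w)) \<phi>)" for x y :: 'v
    unfolding word_hist_def
  proof (rule decidable_subst_family[OF finite_columns decidable_hist_sat])
    show "computable (\<lambda>w s.
        card {i. i < s x \<and> column_at (s x) (drop (Suc (s x) + s y) w) \<tau> i})" for \<tau>
      by (intro computable_card_less decidable_column_at_drop computable_add computable_Suc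
          computable_var visible_var)
  qed (intro visible_card_less visible_var)
  then show ?thesis
    unfolding eval_word_def input_word_def
    by (intro decidable_ex decidable_conj decidable_all_less decidable_letter_at
        decidable_forest_prefix_drop decidable_word_features_drop_subset decidable_no_repeat_drop
        decidable_pinsts_word_drop computable_add computable_Suc computable_var visible_var)
qed

theorem theorem3:
  fixes \<phi> :: fo and xs :: "nat list"
  assumes "distinct xs" and "free_vars \<phi> \<subseteq> set xs"
  shows "Eval \<phi> xs \<in> PTIME"
proof -
  have "Eval \<phi> xs = {w. \<exists>n \<le> length w. \<exists>l \<le> length w. eval_word \<phi> xs w n l}"
    using in_Eval_iff[OF assms(2)] by blast
  then show ?thesis using decidable_in_PTIME[OF decidable_eval_word] by simp
qed

end
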